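(* Every $10$-principal minor of the complex Fourier matrix $\mathcal{F}_{70}$ is nonzero, and every $11$-principal minor of the complex Fourier matrix $\mathcal{F}_{143}$ is nonzero. That is, for $(N,d)\in\{(70,10),(143,11)\}$ and all $R,C\subseteq\mathbb{Z}_N$ with $|R|=|C|$ such that $$\#\{r\in R: r\equiv a \pmod d\}=\#\{c\in C: c\equiv a\pmod d\}\quad\text{for every } a\in\mathbb{Z}_d,$$ one has $\det\mathcal{F}_N[R,C]\neq 0$.
   Context: For an integer $N\ge 2$, $\mathbb{Z}_N=\mathbb{Z}/N\mathbb{Z}$ and the Fourier matrix of order $N$ is the complex matrix $\mathcal{F}_N=(\omega_N^{ij})_{i,j\in\mathbb{Z}_N}$ with $\omega_N=e^{-2\pi i/N}$ (in this last expression $i$ is the imaginary unit). For $R,C\subseteq\mathbb{Z}_N$ of equal cardinality, $\mathcal{F}_N[R,C]$ is the submatrix with rows indexed by $R$ and columns indexed by $C$ (both index sets listed in increasing order of representatives $0,\dots,N-1$; changing the order only affects the sign of the determinant). By convention $\det\mathcal{F}_N[\varnothing,\varnothing]=1$. For $d\mid N$ and $R,C\subseteq\mathbb{Z}_N$ of the same cardinality, the minor with rows $R$ and columns $C$ is called $d$-principal if $\#\{r\in R:r\equiv a\pmod d\}=\#\{c\in C:c\equiv a\pmod d\}$ for every $a\in\mathbb{Z}_d$. *)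

theory Defs
  imports
    Complex_Main
    "Jordan_Normal_Form.Determinant"
    "Jordan_Normal_Form.DL_Submatrix"
begin

(* Z_N is represented by the residues {0..<N}.  The exponent is formed in nat rather than modulo N,
   which is harmless because fourier_root N ^ N = 1 for N > 0. *)

definition fourier_root :: "nat \<Rightarrow> complex" where
  "fourier_root N = exp (- (2 * complex_of_real pi * \<i>) / of_nat N)"

definition fourier_mat :: "nat \<Rightarrow> complex mat" where
  "fourier_mat N = mat N N (\<lambda>(i, j). fourier_root N ^ (i * j))"

(* submatrix lists both index sets in increasing order. *)
definition fourier_minor :: "nat \<Rightarrow> nat set \<Rightarrow> nat set \<Rightarrow> complex" where
  "fourier_minor N R C = det (submatrix (fourier_mat N) R C)"

(* For d dividing N the residue modulo d of a class in Z_N does not depend on the representative. *)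
definition principal_index_sets :: "nat \<Rightarrow> nat set \<Rightarrow> nat set \<Rightarrow> bool" where
  "principal_index_sets d R C \<longleftrightarrow>
     (\<forall>a<d. card {r \<in> R. r mod d = a} = card {c \<in> C. c mod d = a})"

lemma fourier_root_power_self:
  assumes "N > 0"
  shows "fourier_root N ^ N = 1"
proof -
  have "fourier_root N ^ N = exp (of_nat N * (- (2 * complex_of_real pi * \<i>) / of_nat N))"
    unfolding fourier_root_def by (rule exp_of_nat_mult [symmetric])
  also have "of_nat N * (- (2 * complex_of_real pi * \<i>) / of_nat N) = - (2 * complex_of_real pi * \<i>)"
    using assms by simp
  finally show ?thesis
    by (simp add: exp_minus)
qed

lemma fourier_minor_empty: "fourier_minor N {} {} = 1"
  unfolding fourier_minor_def by (rule det_dim_zero) (auto simp: submatrix_def)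

end

theory Submission
  imports Defs "Jordan_Normal_Form.Char_Poly"
begin

text \<open>Write \<open>N = d p\<close> and \<open>\<omega> = \<zeta> \<eta>\<close> with \<open>\<zeta>\<close> a primitive \<open>d\<close>-th and \<open>\<eta>\<close> a primitive \<open>p\<close>-th root of unity.
  Sorting rows and columns by residues modulo \<open>d\<close>, the minor becomes a block matrix with entries
  \<open>\<zeta>^(a b) (\<eta>^r)^c\<close>. Newton interpolation in the rows of each block splits off Vandermonde factors
  and leaves, modulo \<open>1 - \<eta>\<close>, the matrix \<open>(\<zeta>^(a b) (c choose k))\<close>. Newton interpolation in the
  columns turns this into a matrix that is block triangular in the degree \<open>k\<close>, whose diagonal blocks
  are the principal submatrices of the Fourier matrix of order \<open>d\<close> on the sets of residues hit more
  than \<open>k\<close> times; here principality of the index sets enters. So it suffices that all principal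
  minors of the Fourier matrices of order \<open>10\<close> and \<open>11\<close> are units modulo \<open>7\<close> and \<open>13\<close>, respectively.
  By complementation only index sets of size at most \<open>5\<close> matter, and for these the norm of the
  minor is computed.\<close>

section \<open>Cyclotomic integers\<close>

lemma power_mod_order:
  fixes x :: "'a :: comm_ring_1"
  assumes "x ^ d = 1" shows "x ^ (k mod d) = x ^ k"
  by (metis assms mod_mult_div_eq mult.right_neutral power_add power_mult power_one)

text \<open>Multiplication by the value \<open>z\<close> of \<open>q\<close> sends the vector
  \<open>v\<close> of powers of \<open>\<omega>\<close> to integer combinations of its entries,
  since exponents count only modulo \<open>n\<close>. So \<open>z\<close> is an eigenvalue of an
  integer matrix, hence a root of its monic characteristic polynomial.\<close>

lemma algebraic_int_poly_root_of_unity: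
  fixes \<omega> :: complex and q :: "int poly"
  assumes "\<omega> ^ n = 1" "n > 0"
  shows "algebraic_int (poly (map_poly of_int q) \<omega>)"
proof -
  define z where "z = poly (map_poly of_int q) \<omega>"
  define M :: "int mat" where
    "M = mat n n (\<lambda>(i, j). \<Sum>k\<in>{k \<in> {..degree q}. (i + k) mod n = j}. coeff q k)"
  define v where "v = vec n (\<lambda>i. \<omega> ^ i)"
  let ?M = "map_mat complex_of_int M"
  have M: "M \<in> carrier_mat n n" "?M \<in> carrier_mat n n" by (auto simp: M_def)
  have z: "z = (\<Sum>k\<le>degree q. of_int (coeff q k) * \<omega> ^ k)"
    by (simp add: z_def poly_altdef)
  have "?M *\<^sub>v v = z \<cdot>\<^sub>v v"
  proof (rule eq_vecI)
    fix i assume "i < dim_vec (z \<cdot>\<^sub>v v)"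
    then have i: "i < n" by (simp add: v_def)
    have "(?M *\<^sub>v v) $ i
        = (\<Sum>j<n. of_int (\<Sum>k\<in>{k \<in> {..degree q}. (i + k) mod n = j}. coeff q k) * \<omega> ^ j)"
      using i by (auto simp: scalar_prod_def v_def M_def atLeast0LessThan intro!: sum.cong)
    also have "\<dots> = (\<Sum>j<n. \<Sum>k\<in>{k \<in> {..degree q}. (i + k) mod n = j}. of_int (coeff q k) * \<omega> ^ (i + k))"
    proof (rule sum.cong)
      fix j assume "j \<in> {..<n}"
      have "of_int (coeff q k) * \<omega> ^ j = of_int (coeff q k) * \<omega> ^ (i + k)" if "(i + k) mod n = j" for k
        using power_mod_order[OF assms(1), of "i + k"] that by simp
      then show "of_int (\<Sum>k\<in>{k \<in> {..degree q}. (i + k) mod n = j}. coeff q k) * \<omega> ^ j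
          = (\<Sum>k\<in>{k \<in> {..degree q}. (i + k) mod n = j}. of_int (coeff q k) * \<omega> ^ (i + k))"
        by (auto simp: sum_distrib_right intro!: sum.cong)
    qed simp
    also have "\<dots> = (\<Sum>k\<le>degree q. of_int (coeff q k) * \<omega> ^ (i + k))"
      by (rule sum.group) (use assms in auto)
    also have "\<dots> = z * \<omega> ^ i"
      by (simp add: z sum_distrib_left power_add mult_ac)
    finally show "(?M *\<^sub>v v) $ i = (z \<cdot>\<^sub>v v) $ i" using i by (simp add: v_def)
  qed (simp add: M_def v_def)
  moreover have "v \<noteq> 0\<^sub>v n"
    using assms by (auto simp: v_def vec_eq_iff intro!: exI[of _ 0])
  ultimately have "eigenvalue ?M z"
    unfolding eigenvalue_def eigenvector_def using M by (auto simp: v_def intro!: exI[of _ v])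
  then have "poly (char_poly ?M) z = 0"
    using eigenvalue_root_char_poly[OF M(2)] by simp
  moreover have "char_poly ?M = map_poly of_int (char_poly M)"
    by (rule of_int_hom.char_poly_hom[OF M(1)])
  ultimately show ?thesis
    unfolding algebraic_int_altdef_ipoly z_def using degree_monic_char_poly[OF M(1)]
    by (intro exI[of _ "char_poly M"]) auto
qed

text \<open>This is the ring \<open>\<int>[\<omega>]\<close>.\<close>

definition int_span :: "complex \<Rightarrow> complex set" where
  "int_span \<omega> = range (\<lambda>q :: int poly. poly (map_poly of_int q) \<omega>)"

lemma int_span_diff:
  assumes "x \<in> int_span \<omega>" "y \<in> int_span \<omega>" shows "x - y \<in> int_span \<omega>"
proof -
  obtain q r :: "int poly" where "x = poly (map_poly of_int q) \<omega>" "y = poly (map_poly of_int r) \<omega>"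
    using assms by (auto simp: int_span_def)
  then have "x - y = poly (map_poly of_int (q - r)) \<omega>" by (simp add: hom_distribs)
  then show ?thesis by (auto simp: int_span_def)
qed

lemma int_span_mult:
  assumes "x \<in> int_span \<omega>" "y \<in> int_span \<omega>" shows "x * y \<in> int_span \<omega>"
proof -
  obtain q r :: "int poly" where "x = poly (map_poly of_int q) \<omega>" "y = poly (map_poly of_int r) \<omega>"
    using assms by (auto simp: int_span_def)
  then have "x * y = poly (map_poly of_int (q * r)) \<omega>" by (simp add: hom_distribs)
  then show ?thesis by (auto simp: int_span_def)
qed

lemma int_span_1: "1 \<in> int_span \<omega>"
proof -
  have "1 = poly (map_poly of_int (1 :: int poly)) \<omega>" by simp
  then show ?thesis unfolding int_span_def by blast
qed

lemma int_span_power: "\<omega> ^ k \<in> int_span \<omega>"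
proof -
  have "\<omega> ^ k = poly (map_poly of_int (monom 1 k :: int poly)) \<omega>"
    by (simp add: map_poly_monom poly_monom)
  then show ?thesis unfolding int_span_def by blast
qed

text \<open>Rational algebraic integers are integers. This is what later keeps \<open>1 / p\<close>
  out of the ring.\<close>

lemma int_span_rat_int:
  assumes "\<omega> ^ n = 1" "n > 0" "x \<in> int_span \<omega>" "x \<in> \<rat>" shows "x \<in> \<int>"
  using assms algebraic_int_poly_root_of_unity rational_algebraic_int_is_int
  by (auto simp: int_span_def)

section \<open>Residues at a prime above p\<close>

text \<open>\<open>A\<close> stands for a ring of cyclotomic integers. Residues are taken modulo the
  ideal generated by \<open>1 - \<eta>\<close>, which contains \<open>p\<close>, so that no prime
  ideal has to be chosen.\<close>

locale residue_ring_at_p =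
  fixes A :: "complex set" and p :: nat and \<eta> :: complex
  assumes one_mem: "1 \<in> A"
    and diff_mem: "x \<in> A \<Longrightarrow> y \<in> A \<Longrightarrow> x - y \<in> A"
    and mult_mem: "x \<in> A \<Longrightarrow> y \<in> A \<Longrightarrow> x * y \<in> A"
    and rat_mem_int: "x \<in> A \<Longrightarrow> x \<in> \<rat> \<Longrightarrow> x \<in> \<int>"
    and prime_p: "prime p" and odd_p: "odd p"
    and eta_mem: "\<eta> \<in> A" and eta_pow: "\<eta> ^ p = 1" and eta_neq_1: "\<eta> \<noteq> 1"
begin

lemma zero_mem: "0 \<in> A" using diff_mem[OF one_mem one_mem] by simp
lemma uminus_mem: "x \<in> A \<Longrightarrow> - x \<in> A" using diff_mem[OF zero_mem] by simp
lemma add_mem: "x \<in> A \<Longrightarrow> y \<in> A \<Longrightarrow> x + y \<in> A"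
  using diff_mem[of x "- y"] uminus_mem by simp
lemma sum_mem: "(\<And>i. i \<in> I \<Longrightarrow> f i \<in> A) \<Longrightarrow> sum f I \<in> A"
  by (induction I rule: infinite_finite_induct) (auto intro: zero_mem add_mem)
lemma prod_mem: "(\<And>i. i \<in> I \<Longrightarrow> f i \<in> A) \<Longrightarrow> prod f I \<in> A"
  by (induction I rule: infinite_finite_induct) (auto intro: one_mem mult_mem)
lemma power_mem: "x \<in> A \<Longrightarrow> x ^ n \<in> A"
  by (induction n) (auto intro: one_mem mult_mem)
lemma of_nat_mem: "of_nat n \<in> A"
  by (induction n) (auto intro: zero_mem one_mem add_mem)
lemma of_int_mem: "of_int n \<in> A"
  by (cases n) (auto intro: of_nat_mem uminus_mem simp del: of_nat_Suc)

lemmas mem_intros = zero_mem one_mem diff_mem uminus_mem add_mem mult_mem sum_mem prod_mem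
  power_mem of_nat_mem of_int_mem eta_mem

lemma det_mem:
  assumes "\<And>i j. i < n \<Longrightarrow> j < n \<Longrightarrow> f i j \<in> A"
  shows "det (mat n n (\<lambda>(i, j). f i j)) \<in> A"
proof -
  have "signof q \<in> A" for q :: "nat \<Rightarrow> nat"
    by (auto simp: sign_def intro: mem_intros)
  then show ?thesis
    unfolding det_def'[OF mat_carrier]
    by (auto intro!: sum_mem mult_mem prod_mem assms simp: permutes_in_image[where S = "{0..<n}", simplified])
qed

definition cong_eta :: "complex \<Rightarrow> complex \<Rightarrow> bool" (infix "\<approx>" 50) where
  "x \<approx> y \<longleftrightarrow> (\<exists>z\<in>A. x - y = (1 - \<eta>) * z)"

lemma cong_eta_refl [simp]: "x \<approx> x"
  unfolding cong_eta_def using zero_mem by force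

lemma cong_eta_sym: "x \<approx> y \<Longrightarrow> y \<approx> x"
  unfolding cong_eta_def by (metis minus_diff_eq mult_minus_right uminus_mem)

lemma cong_eta_add: "x \<approx> y \<Longrightarrow> x' \<approx> y' \<Longrightarrow> x + x' \<approx> y + y'"
  unfolding cong_eta_def by (metis (no_types, lifting) add_diff_add add_mem distrib_left)

lemma cong_eta_trans: "x \<approx> y \<Longrightarrow> y \<approx> z \<Longrightarrow> x \<approx> z"
  using cong_eta_add[of x y y z] by (auto simp: cong_eta_def)

lemma cong_eta_mult_left: "x \<approx> y \<Longrightarrow> a \<in> A \<Longrightarrow> a * x \<approx> a * y"
  unfolding cong_eta_def
  by (metis mult.left_commute mult_mem right_diff_distrib)

lemma cong_eta_mult:
  assumes "x \<approx> y" "x' \<approx> y'" "x \<in> A" "y' \<in> A"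
  shows "x * x' \<approx> y * y'"
  using cong_eta_mult_left[OF assms(2,3)] cong_eta_mult_left[OF assms(1,4)]
  by (auto simp: mult.commute intro: cong_eta_trans)

lemma cong_eta_sum: "(\<And>i. i \<in> I \<Longrightarrow> f i \<approx> g i) \<Longrightarrow> sum f I \<approx> sum g I"
  by (induction I rule: infinite_finite_induct) (auto intro: cong_eta_add)

lemma cong_eta_prod:
  "(\<And>i. i \<in> I \<Longrightarrow> f i \<approx> g i \<and> f i \<in> A \<and> g i \<in> A) \<Longrightarrow> prod f I \<approx> prod g I"
  by (induction I rule: infinite_finite_induct) (auto intro!: cong_eta_mult prod_mem)

lemma cong_eta_det:
  assumes "\<And>i j. i < n \<Longrightarrow> j < n \<Longrightarrow> f i j \<in> A \<and> g i j \<in> A \<and> f i j \<approx> g i j"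
  shows "det (mat n n (\<lambda>(i, j). f i j)) \<approx> det (mat n n (\<lambda>(i, j). g i j))"
proof -
  have s: "signof q \<in> A" for q :: "nat \<Rightarrow> nat"
    by (auto simp: sign_def intro: mem_intros)
  show ?thesis
    unfolding det_def'[OF mat_carrier]
    by (auto intro!: cong_eta_sum cong_eta_mult_left cong_eta_prod s simp: assms permutes_in_image[where S = "{0..<n}", simplified])
qed

lemma eta_cong_1: "\<eta> \<approx> 1"
  unfolding cong_eta_def using uminus_mem[OF one_mem] by (intro bexI[of _ "-1"]) auto

text \<open>The powers of \<open>\<eta>\<close> below \<open>p\<close> sum to zero, while each of
  these \<open>p\<close> terms is congruent to \<open>1\<close>.\<close>

lemma p_cong_0: "of_nat p \<approx> 0"
proof -
  have "(\<Sum>i<p. \<eta> ^ i) = 0"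
    using geometric_sum[OF eta_neq_1, of p] eta_pow by simp
  moreover have "(\<Sum>i<p. \<eta> ^ i) \<approx> (\<Sum>i<p. 1)"
  proof (rule cong_eta_sum)
    fix i show "\<eta> ^ i \<approx> 1"
      using cong_eta_prod[of "{..<i}" "\<lambda>_. \<eta>" "\<lambda>_. 1"] eta_cong_1 by (auto intro: mem_intros)
  qed
  ultimately show ?thesis by (auto intro: cong_eta_sym)
qed

text \<open>The binomial theorem gives \<open>(1 - \<eta>)\<^sup>p \<in> p A\<close>; hence if \<open>1 - \<eta>\<close> divided
  \<open>1\<close> in \<open>A\<close>, then \<open>1 / p\<close> would lie in \<open>A\<close>.\<close>

lemma one_not_cong_0: "\<not> 1 \<approx> 0"
proof
  assume "1 \<approx> 0"
  then obtain w where w: "w \<in> A" "(1 - \<eta>) * w = 1" unfolding cong_eta_def by auto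
  have p0: "p > 0" using prime_p by (simp add: prime_gt_0_nat)
  have "(1 - \<eta>) ^ p = (- \<eta> + 1) ^ p" by simp
  also have "\<dots> = (\<Sum>k\<le>p. of_nat (p choose k) * (- \<eta>) ^ k)"
    by (subst binomial_ring) simp
  also have "{..p} = insert 0 (insert p {0<..<p})" using p0 by auto
  \<comment> \<open>The outer terms are \<open>1\<close> and \<open>(- \<eta>) ^ p = -1\<close>, as
    \<open>p\<close> is odd, and cancel.\<close>
  also have "(\<Sum>k\<in>\<dots>. of_nat (p choose k) * (- \<eta>) ^ k)
     = (\<Sum>k\<in>{0<..<p}. of_nat (p choose k) * (- \<eta>) ^ k)"
    using p0 odd_p eta_pow by simp
  also have "\<dots> = (\<Sum>k\<in>{0<..<p}. of_nat p * (of_nat ((p choose k) div p) * (- \<eta>) ^ k))"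
  proof (rule sum.cong)
    fix k assume k: "k \<in> {0<..<p}"
    then have "p dvd (p choose k)" using prime_p by (intro dvd_choose_prime) auto
    then have "(p choose k) = p * ((p choose k) div p)" by simp
    then show "of_nat (p choose k) * (- \<eta>) ^ k = of_nat p * (of_nat ((p choose k) div p) * (- \<eta>) ^ k)"
      by (metis mult.assoc of_nat_mult)
  qed simp
  also have "\<dots> = of_nat p * (\<Sum>k\<in>{0<..<p}. of_nat ((p choose k) div p) * (- \<eta>) ^ k)"
    by (simp add: sum_distrib_left)
  finally obtain u where u: "u \<in> A" "(1 - \<eta>) ^ p = of_nat p * u"
    by (intro that[of "\<Sum>k\<in>{0<..<p}. of_nat ((p choose k) div p) * (- \<eta>) ^ k"])
      (auto intro!: sum_mem mult_mem of_nat_mem power_mem uminus_mem eta_mem)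
  have "1 = ((1 - \<eta>) * w) ^ p" using w by simp
  also have "\<dots> = of_nat p * (u * w ^ p)" using u by (simp add: power_mult_distrib)
  finally have eq: "u * w ^ p = 1 / of_nat p" using p0 by (simp add: field_simps)
  have "u * w ^ p \<in> A" by (intro mult_mem power_mem u w)
  moreover have "u * w ^ p \<in> \<rat>" by (simp add: eq)
  ultimately have "u * w ^ p \<in> \<int>" by (rule rat_mem_int)
  then obtain k :: int where "1 / of_nat p = (of_int k :: complex)"
    unfolding eq by (auto elim: Ints_cases)
  then have "(of_int 1 :: complex) = of_int (int p * k)" using p0 by (simp add: field_simps)
  then have "1 = int p * k" by (simp only: of_int_eq_iff)
  then have "int p dvd 1" by (metis dvd_triv_left)
  then show False using prime_p by auto
qed

text \<open>Units of the quotient of \<open>A\<close> by \<open>1 - \<eta>\<close>. Asking for an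
  inverse instead of a nonzero residue makes the notion multiplicative without primality of the
  ideal.\<close>

definition res_unit :: "complex \<Rightarrow> bool" where
  "res_unit x \<longleftrightarrow> x \<in> A \<and> (\<exists>q\<in>A. x * q \<approx> 1)"

lemma res_unit_mem: "res_unit x \<Longrightarrow> x \<in> A"
  by (simp add: res_unit_def)

lemma res_unit_nonzero: "res_unit x \<Longrightarrow> x \<noteq> 0"
  using one_not_cong_0 cong_eta_sym by (auto simp: res_unit_def)

lemma res_unit_1: "res_unit 1"
  unfolding res_unit_def using one_mem by force

lemma res_unit_mult: 
  assumes "res_unit x" "res_unit y" shows "res_unit (x * y)"
proof -
  obtain q r where "q \<in> A" "r \<in> A" "x * q \<approx> 1" "y * r \<approx> 1" "x \<in> A" "y \<in> A"
    using assms unfolding res_unit_def by auto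
  then show ?thesis
    using cong_eta_mult[of "x * q" 1 "y * r" 1] unfolding res_unit_def
    by (intro conjI bexI[of _ "q * r"]) (auto intro: mem_intros simp: mult_ac)
qed

lemma res_unit_prod: "(\<And>i. i \<in> I \<Longrightarrow> res_unit (f i)) \<Longrightarrow> res_unit (prod f I)"
  by (induction I rule: infinite_finite_induct) (auto intro: res_unit_1 res_unit_mult)

text \<open>Divisors of units are units. Through this, a computable multiple of an element, such as
  its norm, certifies the element itself.\<close>

lemma res_unit_factor: "res_unit (x * y) \<Longrightarrow> x \<in> A \<Longrightarrow> y \<in> A \<Longrightarrow> res_unit x"
  unfolding res_unit_def by (metis mult.assoc mult_mem)

lemma res_unit_cong: 
  assumes "res_unit x" "x \<approx> y" "y \<in> A" shows "res_unit y"
proof -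
  obtain q where q: "q \<in> A" "x * q \<approx> 1" using assms unfolding res_unit_def by auto
  have "y * q \<approx> x * q" using cong_eta_mult_left[OF cong_eta_sym[OF assms(2)] q(1)] 
    by (simp add: mult.commute)
  then show ?thesis using q assms(3) cong_eta_trans unfolding res_unit_def by blast
qed

text \<open>A Bezout identity \<open>m * a + p * b = 1\<close> becomes \<open>m * a\<close>
  congruent to \<open>1\<close>, because \<open>p\<close> vanishes in the quotient.\<close>

lemma res_unit_of_int:
  assumes "\<not> int p dvd m" shows "res_unit (of_int m)"
proof -
  have "coprime m (int p)"
    using assms prime_p prime_imp_coprime[of "int p" m] by (simp add: coprime_commute)
  then obtain a b where ab: "m * a + int p * b = 1"
    by (metis bezout_int coprime_iff_gcd_eq_1 mult.commute)
  have "of_int (int p * b) \<approx> 0"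
    using cong_eta_mult_left[OF p_cong_0 of_int_mem[of b]] by (simp add: mult.commute)
  then have "of_int (m * a) + 0 \<approx> of_int (m * a) + of_int (int p * b)"
    by (intro cong_eta_add) (auto intro: cong_eta_sym)
  also have "of_int (m * a) + of_int (int p * b) = (1 :: complex)"
    using ab by (metis of_int_1 of_int_add)
  finally show ?thesis
    unfolding res_unit_def by (intro conjI bexI[of _ "of_int a"]) (auto intro: mem_intros)
qed

lemma of_int_mod_cong: "of_int (a mod int p) \<approx> of_int a"
proof -
  have "of_int a = of_int (a mod int p) + of_int (int p * (a div int p))"
    by (metis mod_mult_div_eq of_int_add)
  moreover have "of_int (int p * (a div int p)) \<approx> 0"
    using cong_eta_mult_left[OF p_cong_0 of_int_mem[of "a div int p"]] by (simp add: mult.commute)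
  ultimately have "of_int a \<approx> of_int (a mod int p) + 0"
    using cong_eta_add[OF cong_eta_refl] by metis
  then show ?thesis using cong_eta_sym by simp
qed

lemma res_unit_root:
  assumes "x \<in> A" "x ^ n = 1" "n > 0" shows "res_unit x"
proof -
  have "x * x ^ (n - 1) = 1" using assms by (metis power_minus_mult mult.commute)
  then show ?thesis unfolding res_unit_def using assms by (auto intro!: bexI[of _ "x ^ (n - 1)"] mem_intros)
qed

end

section \<open>Level-triangular determinants and Newton interpolation\<close>

lemma det_diagonal_fun:
  fixes f :: "nat \<Rightarrow> 'a :: comm_ring_1"
  shows "det (mat n n (\<lambda>(i, j). if i = j then f i else 0)) = (\<Prod>i<n. f i)"
proof -
  have "det (mat n n (\<lambda>(i, j). if i = j then f i else 0))
      = prod_list (diag_mat (mat n n (\<lambda>(i, j). if i = j then f i else 0)))"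
    by (rule det_lower_triangular[OF _ mat_carrier]) auto
  then show ?thesis by (simp add: prod_list_diag_prod atLeast0LessThan)
qed

text \<open>A permutation contributing to the determinant never raises the level, hence preserves it,
  because the levels before and after have the same sum.\<close>

lemma det_level_triangular:
  fixes f :: "nat \<Rightarrow> nat \<Rightarrow> 'a :: comm_ring_1" and lev :: "nat \<Rightarrow> nat"
  assumes zero: "\<And>i j. i < n \<Longrightarrow> j < n \<Longrightarrow> lev i < lev j \<Longrightarrow> f i j = 0"
  shows "det (mat n n (\<lambda>(i, j). f i j))
       = det (mat n n (\<lambda>(i, j). if lev i = lev j then f i j else 0))"
proof -
  have "(\<Prod>i = 0..<n. f i (q i)) = (\<Prod>i = 0..<n. if lev i = lev (q i) then f i (q i) else 0)"
    if q: "q permutes {0..<n}" for q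
  proof (cases "\<forall>i<n. lev (q i) \<le> lev i")
    case True
    have "(\<Sum>i\<in>{0..<n}. lev (q i)) = (\<Sum>i\<in>{0..<n}. lev i)"
      using sum.permute[OF q, of lev] by (simp add: comp_def)
    then have "lev (q i) = lev i" if "i \<in> {0..<n}" for i
      using True that by (intro sum_mono_inv[of "\<lambda>i. lev (q i)" "{0..<n}" lev]) auto
    then show ?thesis by (intro prod.cong) auto
  next
    case False
    then obtain i where i: "i < n" "lev i < lev (q i)" by (auto simp: not_le)
    have "q i < n" using permutes_in_image[OF q, of i] i by simp
    then have "f i (q i) = 0" using zero i by blast
    then have "\<exists>i\<in>{0..<n}. f i (q i) = 0" using i by (intro bexI[of _ i]) auto
    moreover from this have "\<exists>i\<in>{0..<n}. (if lev i = lev (q i) then f i (q i) else 0) = 0" by auto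
    ultimately show ?thesis
      using prod_zero[of "{0..<n}" "\<lambda>i. f i (q i)"]
        prod_zero[of "{0..<n}" "\<lambda>i. if lev i = lev (q i) then f i (q i) else 0"] by simp
  qed
  moreover have "(\<Prod>i = 0..<n. mat n n (\<lambda>(i, j). g i j) $$ (i, q i)) = (\<Prod>i = 0..<n. g i (q i))"
    if q: "q permutes {0..<n}" for q and g :: "nat \<Rightarrow> nat \<Rightarrow> 'a"
    using permutes_in_image[OF q] by (intro prod.cong) auto
  ultimately show ?thesis
    unfolding det_def'[OF mat_carrier] by (intro sum.cong refl) simp
qed

text \<open>The Newton coefficients \<open>newton_coeff x s k j\<close> are the divided differences over the nodes
  \<open>x 0, \<dots>, x k\<close> of the polynomial \<open>\<Prod>m<j. y - s m\<close>.\<close>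

fun newton_coeff :: "(nat \<Rightarrow> 'a :: comm_ring_1) \<Rightarrow> (nat \<Rightarrow> 'a) \<Rightarrow> nat \<Rightarrow> nat \<Rightarrow> 'a" where
  "newton_coeff x s 0 0 = 1"
| "newton_coeff x s (Suc k) 0 = 0"
| "newton_coeff x s 0 (Suc j) = (x 0 - s j) * newton_coeff x s 0 j"
| "newton_coeff x s (Suc k) (Suc j) =
     (x (Suc k) - s j) * newton_coeff x s (Suc k) j + newton_coeff x s k j"

lemma newton_coeff_above: "j < k \<Longrightarrow> newton_coeff x s k j = 0"
  by (induction x s k j rule: newton_coeff.induct) auto

lemma newton_coeff_diag: "newton_coeff x s k k = 1"
  by (induction k) (auto simp: newton_coeff_above)

text \<open>In the step from \<open>j\<close> to \<open>Suc j\<close>, the new factor is split as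
  \<open>x i - s j = (x k - s j) + (x i - x k)\<close>; the second summand lengthens the Newton
  product from \<open>k\<close> to \<open>Suc k\<close>.\<close>

lemma newton_interpolation:
  fixes x :: "nat \<Rightarrow> 'a :: comm_ring_1"
  shows "(\<Prod>m<j. x i - s m) = (\<Sum>k\<le>i. newton_coeff x s k j * (\<Prod>l<k. x i - x l))"
proof (induction j)
  case 0
  have "(\<Sum>k\<le>i. newton_coeff x s k 0 * (\<Prod>l<k. x i - x l)) = (\<Sum>k\<le>i. if k = 0 then 1 else 0)"
    by (rule sum.cong) (auto simp: newton_coeff_above)
  then show ?case by simp
next
  case (Suc j)
  let ?P = "\<lambda>k. \<Prod>l<k. x i - x l" and ?h = "\<lambda>k. newton_coeff x s k j"
  have "(\<Prod>m<Suc j. x i - s m) = (\<Sum>k\<le>i. (x i - s j) * (?h k * ?P k))"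
    by (simp add: Suc.IH sum_distrib_left mult.commute)
  also have "\<dots> = (\<Sum>k\<le>i. (x k - s j) * ?h k * ?P k) + (\<Sum>k\<le>i. ?h k * ?P (Suc k))"
    unfolding sum.distrib[symmetric] by (rule sum.cong) (auto simp: algebra_simps)
  \<comment> \<open>The term \<open>k = i\<close> vanishes, since \<open>?P (Suc i)\<close> contains
    the factor \<open>x i - x i\<close>.\<close>
  also have "(\<Sum>k\<le>i. ?h k * ?P (Suc k)) = (\<Sum>k<i. ?h k * ?P (Suc k))"
    by (simp add: lessThan_Suc_atMost[symmetric])
  also have "(\<Sum>k\<le>i. (x k - s j) * ?h k * ?P k) + (\<Sum>k<i. ?h k * ?P (Suc k))
      = (\<Sum>k\<le>i. newton_coeff x s k (Suc j) * ?P k)"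
  proof (cases i)
    case (Suc i')
    show ?thesis
      unfolding Suc sum.atMost_Suc_shift lessThan_Suc_atMost
      by (simp add: distrib_right sum.distrib del: prod.lessThan_Suc sum.atMost_Suc)
  qed simp
  finally show ?case .
qed
text \<open>Two enumerations of the same set differ by a permutation, which changes the determinant
  only by a sign. Since only vanishing matters, the sign is dropped.\<close>

lemma det_reindex_eq_0:
  fixes F :: "'b \<Rightarrow> nat \<Rightarrow> 'a :: comm_ring_1"
  assumes f: "bij_betw f {0..<n} R" and g: "bij_betw g {0..<n} R"
    and 0: "det (mat n n (\<lambda>(i, j). F (g i) j)) = 0"
  shows "det (mat n n (\<lambda>(i, j). F (f i) j)) = 0"
proof -
  define q where "q = (\<lambda>i. if i < n then inv_into {0..<n} g (f i) else i)"
  have "bij_betw (inv_into {0..<n} g \<circ> f) {0..<n} {0..<n}"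
    using bij_betw_trans[OF f bij_betw_inv_into[OF g]] .
  then have "bij_betw q {0..<n} {0..<n}"
    by (subst bij_betw_cong[of _ _ "inv_into {0..<n} g \<circ> f"]) (auto simp: q_def)
  then have q: "q permutes {0..<n}"
    by (intro bij_imp_permutes) (auto simp: q_def)
  have "f i \<in> R" if "i < n" for i using bij_betwE[OF f] that by simp
  then have gq: "g (q i) = f i" if "i < n" for i
    using that bij_betw_inv_into_right[OF g] by (simp add: q_def)
  have lt: "q i < n" if "i < n" for i using permutes_in_image[OF q, of i] that by simp
  have "mat n n (\<lambda>(i, j). F (f i) j)
      = mat n n (\<lambda>(i, j). mat n n (\<lambda>(i, j). F (g i) j) $$ (q i, j))"
    using lt gq by (auto intro!: eq_matI)
  then show ?thesis
    using det_permute_rows[OF mat_carrier q, of "\<lambda>(i, j). F (g i) j"] 0 by simp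
qed

section \<open>Principal submatrices of Fourier matrices\<close>

context residue_ring_at_p begin

text \<open>The Fourier matrix restricted to \<open>S \<times> S\<close> is invertible modulo every maximal ideal
  of \<open>A\<close> above \<open>1 - \<eta>\<close>.\<close>

definition nonsing :: "complex \<Rightarrow> nat set \<Rightarrow> bool" where
  "nonsing \<zeta> S \<longleftrightarrow> (\<exists>X z. (\<forall>a\<in>S. \<forall>b\<in>S. X a b \<in> A) \<and> res_unit z \<and>
     (\<forall>a\<in>S. \<forall>c\<in>S. (\<Sum>b\<in>S. X a b * \<zeta> ^ (b * c)) = (if a = c then z else 0)))"

lemma nonsing_empty: "nonsing \<zeta> {}"
  unfolding nonsing_def using res_unit_1 by auto

text \<open>Expanding \<open>(u * b + t) * (u * c + t)\<close> shows that the matrix on the image is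
  the one on \<open>S\<close> for the root \<open>\<zeta> ^ (u * u)\<close>, with rows and columns
  scaled by roots of unity.\<close>

lemma nonsing_affine_image:
  assumes ns: "nonsing (\<zeta> ^ (u * u)) S" and inj: "inj_on (\<lambda>x. (u * x + t) mod d) S"
    and \<zeta>: "\<zeta> \<in> A" "\<zeta> ^ d = 1" "d > 0"
  shows "nonsing \<zeta> ((\<lambda>x. (u * x + t) mod d) ` S)"
proof -
  let ?f = "\<lambda>x. (u * x + t) mod d"
  define r where "r = the_inv_into S ?f"
  have r: "r (?f x) = x" if "x \<in> S" for x
    unfolding r_def using the_inv_into_f_f[OF inj that] by simp
  obtain X z where X: "\<And>a b. a \<in> S \<Longrightarrow> b \<in> S \<Longrightarrow> X a b \<in> A" and z: "res_unit z"
    and eq: "\<And>a c. a \<in> S \<Longrightarrow> c \<in> S \<Longrightarrow>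
      (\<Sum>b\<in>S. X a b * (\<zeta> ^ (u * u)) ^ (b * c)) = (if a = c then z else 0)"
    using ns unfolding nonsing_def by blast
  \<comment> \<open>The inverse of \<open>\<zeta>\<close>, written as a power so that it visibly
    lies in \<open>A\<close>.\<close>
  define \<theta> where "\<theta> = \<zeta> ^ (d - 1)"
  have \<theta>: "\<theta> * \<zeta> = 1" unfolding \<theta>_def using \<zeta> by (metis power_minus_mult)
  have \<theta>A: "\<theta> \<in> A" unfolding \<theta>_def using \<zeta> by (intro power_mem)
  have cancel: "\<theta> ^ k * \<zeta> ^ k = 1" for k using \<theta> by (metis power_mult_distrib power_one)
  \<comment> \<open>The outer factors undo the scalings \<open>\<zeta> ^ (u * t * b)\<close> and
    \<open>\<zeta> ^ (u * t * c)\<close> of rows and columns.\<close>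
  define Y where "Y = (\<lambda>a b. \<theta> ^ (u * t * r a) * X (r a) (r b) * \<theta> ^ (u * t * r b))"
  have "(\<Sum>b\<in>?f ` S. Y a b * \<zeta> ^ (b * c)) = (if a = c then \<zeta> ^ (t * t) * z else 0)"
    if ac: "a \<in> ?f ` S" "c \<in> ?f ` S" for a c
  proof -
    obtain a' c' where a': "a' \<in> S" "a = ?f a'" and c': "c' \<in> S" "c = ?f c'" using ac by blast
    have summand: "Y a (?f b) * \<zeta> ^ (?f b * c) = \<theta> ^ (u * t * a') * \<zeta> ^ (u * t * c') * \<zeta> ^ (t * t)
        * (X a' b * (\<zeta> ^ (u * u)) ^ (b * c'))" if b: "b \<in> S" for b
    proof -
      have Y: "Y a (?f b) = \<theta> ^ (u * t * a') * X a' b * \<theta> ^ (u * t * b)"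
        unfolding Y_def a'(2) r[OF a'(1)] r[OF b] ..
      have "\<zeta> ^ (?f b * c) = \<zeta> ^ ((u * b + t) * (u * c' + t))"
        unfolding c' using power_mod_order[OF \<zeta>(2)] by (metis mod_mult_eq)
      also have "(u * b + t) * (u * c' + t) = u * u * (b * c') + u * t * b + u * t * c' + t * t"
        by (simp add: algebra_simps)
      also have "\<zeta> ^ \<dots> = (\<zeta> ^ (u * u)) ^ (b * c') * \<zeta> ^ (u * t * b) * \<zeta> ^ (u * t * c') * \<zeta> ^ (t * t)"
        by (simp only: power_add power_mult)
      finally have "Y a (?f b) * \<zeta> ^ (?f b * c) = \<theta> ^ (u * t * a') * \<zeta> ^ (u * t * c') * \<zeta> ^ (t * t)
        * (X a' b * (\<zeta> ^ (u * u)) ^ (b * c')) * (\<theta> ^ (u * t * b) * \<zeta> ^ (u * t * b))"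
        unfolding Y by (simp only: mult_ac)
      then show ?thesis by (simp add: cancel)
    qed
    have "(\<Sum>b\<in>?f ` S. Y a b * \<zeta> ^ (b * c)) = (\<Sum>b\<in>S. Y a (?f b) * \<zeta> ^ (?f b * c))"
      using sum.reindex[OF inj, of "\<lambda>b. Y a b * \<zeta> ^ (b * c)"] by (simp add: comp_def)
    also have "\<dots> = \<theta> ^ (u * t * a') * \<zeta> ^ (u * t * c') * \<zeta> ^ (t * t) * (if a' = c' then z else 0)"
      by (simp only: summand eq[OF a'(1) c'(1), symmetric] sum_distrib_left cong: sum.cong)
    also have "\<dots> = (if a = c then \<zeta> ^ (t * t) * z else 0)"
      using a' c' inj by (auto simp: cancel inj_on_eq_iff[OF inj])
    finally show ?thesis .
  qed
  moreover have "Y a b \<in> A" if "a \<in> ?f ` S" "b \<in> ?f ` S" for a b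
    using that X r by (auto simp: Y_def intro!: mult_mem power_mem \<theta>A)
  moreover have "(\<zeta> ^ (t * t)) ^ d = 1"
    by (metis \<zeta>(2) mult.commute power_mult power_one)
  then have "res_unit (\<zeta> ^ (t * t) * z)"
    using res_unit_mult[OF res_unit_root[of "\<zeta> ^ (t * t)" d] z] power_mem \<zeta> by blast
  ultimately show ?thesis unfolding nonsing_def by blast
qed

text \<open>The summands are the powers of \<open>\<theta> ^ a * \<zeta> ^ c\<close>, a
  \<open>d\<close>-th root of unity that equals \<open>1\<close> only for \<open>a = c\<close>;
  otherwise the geometric sum vanishes.\<close>

lemma fourier_orthogonality:
  fixes \<zeta> \<theta> :: complex
  assumes prim: "\<And>k. 0 < k \<Longrightarrow> k < d \<Longrightarrow> \<zeta> ^ k \<noteq> 1" and "\<zeta> ^ d = 1" "\<theta> * \<zeta> = 1" "a < d" "c < d"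
  shows "(\<Sum>b<d. \<theta> ^ (a * b) * \<zeta> ^ (b * c)) = (if a = c then of_nat d else 0)"
proof -
  have cancel: "\<theta> ^ k * \<zeta> ^ k = 1" for k using assms(3) by (metis power_mult_distrib power_one)
  define r where "r = \<theta> ^ a * \<zeta> ^ c"
  have r: "\<theta> ^ (a * b) * \<zeta> ^ (b * c) = r ^ b" for b
    by (simp add: r_def power_mult_distrib mult.commute flip: power_mult)
  show ?thesis
  proof (cases "a = c")
    case True
    then have "r = 1" by (simp add: r_def cancel)
    then show ?thesis using True unfolding r by simp
  next
    case False
    have "r \<noteq> 1"
    proof
      assume "r = 1"
      then have "\<zeta> ^ a = \<zeta> ^ a * (\<theta> ^ a * \<zeta> ^ c)" by (simp add: r_def)
      also have "\<dots> = \<zeta> ^ c" using cancel[of a] by (simp add: mult_ac)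
      finally have eq: "\<zeta> ^ a = \<zeta> ^ c" .
      have "\<zeta> \<noteq> 0" using assms(3) by auto
      then have "\<zeta> ^ (max a c - min a c) = 1"
        using eq by (simp add: power_diff max_def min_def)
      then show False using prim[of "max a c - min a c"] False assms by auto
    qed
    moreover have "r ^ d = 1"
      unfolding r_def power_mult_distrib using assms(2) cancel[of d]
      by (simp flip: power_mult add: mult.commute[of _ d]) (simp add: power_mult)
    ultimately have "(\<Sum>b<d. r ^ b) = 0" using geometric_sum[of r d] by simp
    then show ?thesis using False unfolding r by simp
  qed
qed

text \<open>The complementary minor of the inverse matrix, via the Schur complement formula
  \<open>P\<inverse> = P' - Q' T'\<inverse> R'\<close> for the blocks of a matrix and of its inverse.\<close>

lemma nonsing_complement:
  assumes prim: "\<And>k. 0 < k \<Longrightarrow> k < d \<Longrightarrow> \<zeta> ^ k \<noteq> 1" and \<zeta>: "\<zeta> \<in> A" "\<zeta> ^ d = 1" "\<theta> \<in> A" "\<theta> * \<zeta> = 1"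
    and d: "\<not> p dvd d" and S: "S \<subseteq> {..<d}"
    and ns: "nonsing \<theta> ({..<d} - S)"
  shows "nonsing \<zeta> S"
proof -
  define T where "T = {..<d} - S"
  have fin: "finite S" "finite T" using S finite_subset by (auto simp: T_def)
  obtain X z where X: "\<And>a b. a \<in> T \<Longrightarrow> b \<in> T \<Longrightarrow> X a b \<in> A" and z: "res_unit z"
    and eq: "\<And>a c. a \<in> T \<Longrightarrow> c \<in> T \<Longrightarrow> (\<Sum>b\<in>T. X a b * \<theta> ^ (b * c)) = (if a = c then z else 0)"
    using ns unfolding nonsing_def T_def by blast
  have split: "(\<Sum>b\<in>S. \<theta> ^ (a * b) * \<zeta> ^ (b * c)) + (\<Sum>b\<in>T. \<theta> ^ (a * b) * \<zeta> ^ (b * c))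
      = (if a = c then of_nat d else 0)" if "a < d" "c < d" for a c
    using fourier_orthogonality[OF prim \<zeta>(2,4) that] S
      sum.subset_diff[of S "{..<d}" "\<lambda>b. \<theta> ^ (a * b) * \<zeta> ^ (b * c)"]
    by (simp add: T_def add.commute)
  \<comment> \<open>The Schur complement formula cleared of denominators: \<open>X\<close> is
    \<open>z\<close> times the inverse of the block on \<open>T\<close>, so the whole formula is
    multiplied by \<open>z\<close>.\<close>
  define Y where "Y = (\<lambda>a b. z * \<theta> ^ (a * b) - (\<Sum>t\<in>T. \<Sum>t'\<in>T. \<theta> ^ (a * t) * X t t' * \<theta> ^ (t' * b)))"
  have "(\<Sum>b\<in>S. Y a b * \<zeta> ^ (b * c)) = (if a = c then z * of_nat d else 0)"
    if ac: "a \<in> S" "c \<in> S" for a c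
  proof -
    have acd: "a < d" "c < d" using ac S by auto
    \<comment> \<open>Row \<open>t'\<close> lies in \<open>T\<close> and column \<open>c\<close> in
      \<open>S\<close>, so they differ and the full orthogonality sum is zero.\<close>
    have neg: "(\<Sum>b\<in>S. \<theta> ^ (t' * b) * \<zeta> ^ (b * c)) = - (\<Sum>b\<in>T. \<theta> ^ (t' * b) * \<zeta> ^ (b * c))"
      if "t' \<in> T" for t'
      using split[of t' c] that ac acd by (auto simp: T_def add_eq_0_iff split: if_splits)
    have "(\<Sum>b\<in>S. \<Sum>t\<in>T. \<Sum>t'\<in>T. \<theta> ^ (a * t) * X t t' * \<theta> ^ (t' * b) * \<zeta> ^ (b * c))
        = (\<Sum>t\<in>T. \<Sum>t'\<in>T. \<theta> ^ (a * t) * X t t' * (\<Sum>b\<in>S. \<theta> ^ (t' * b) * \<zeta> ^ (b * c)))"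
      by (subst sum.swap, rule sum.cong, simp, subst sum.swap) (simp add: sum_distrib_left mult.assoc)
    also have "\<dots> = - (\<Sum>t\<in>T. \<Sum>t'\<in>T. \<Sum>b\<in>T. \<theta> ^ (a * t) * X t t' * (\<theta> ^ (t' * b) * \<zeta> ^ (b * c)))"
      by (simp add: neg sum_negf sum_distrib_left)
    also have "(\<Sum>t\<in>T. \<Sum>t'\<in>T. \<Sum>b\<in>T. \<theta> ^ (a * t) * X t t' * (\<theta> ^ (t' * b) * \<zeta> ^ (b * c)))
        = (\<Sum>t\<in>T. \<Sum>b\<in>T. \<theta> ^ (a * t) * \<zeta> ^ (b * c) * (\<Sum>t'\<in>T. X t t' * \<theta> ^ (t' * b)))"
      by (rule sum.cong, simp, subst sum.swap) (simp add: sum_distrib_left mult_ac)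
    also have "\<dots> = (\<Sum>t\<in>T. \<Sum>b\<in>T. if t = b then z * (\<theta> ^ (a * b) * \<zeta> ^ (b * c)) else 0)"
      by (intro sum.cong refl) (auto simp: eq)
    also have "\<dots> = z * (\<Sum>b\<in>T. \<theta> ^ (a * b) * \<zeta> ^ (b * c))"
      using fin by (simp add: sum_distrib_left)
    finally have "(\<Sum>b\<in>S. \<Sum>t\<in>T. \<Sum>t'\<in>T. \<theta> ^ (a * t) * X t t' * \<theta> ^ (t' * b) * \<zeta> ^ (b * c))
        = - (z * (\<Sum>b\<in>T. \<theta> ^ (a * b) * \<zeta> ^ (b * c)))" .
    then have "(\<Sum>b\<in>S. Y a b * \<zeta> ^ (b * c))
        = z * ((\<Sum>b\<in>S. \<theta> ^ (a * b) * \<zeta> ^ (b * c)) + (\<Sum>b\<in>T. \<theta> ^ (a * b) * \<zeta> ^ (b * c)))"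
      by (simp add: Y_def left_diff_distrib sum_subtractf sum_distrib_right distrib_left sum_distrib_left mult.assoc)
    then show ?thesis using split[OF acd] by simp
  qed
  moreover have "Y a b \<in> A" for a b
    using X res_unit_mem[OF z] by (auto simp: Y_def intro!: diff_mem mult_mem sum_mem power_mem \<zeta>)
  moreover have "res_unit (z * of_nat d)"
    using z res_unit_of_int[of "int d"] d by (auto intro: res_unit_mult)
  ultimately show ?thesis unfolding nonsing_def by blast
qed

text \<open>The adjugate serves as \<open>X\<close> and the determinant as \<open>z\<close>; the
  entries of the adjugate are signed minors and so stay in \<open>A\<close>.\<close>

lemma nonsing_of_det:
  assumes "\<zeta> \<in> A" and xs: "distinct xs"
    and det: "res_unit (det (mat (length xs) (length xs) (\<lambda>(i, j). \<zeta> ^ (xs ! i * xs ! j))))"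
  shows "nonsing \<zeta> (set xs)"
proof -
  let ?n = "length xs"
  define M where "M = mat ?n ?n (\<lambda>(i, j). \<zeta> ^ (xs ! i * xs ! j))"
  have M: "M \<in> carrier_mat ?n ?n" by (simp add: M_def)
  have bij: "bij_betw (nth xs) {..<?n} (set xs)" using xs by (rule bij_betw_nth) auto
  define r where "r = the_inv_into {..<?n} (nth xs)"
  have r: "r (xs ! i) = i" if "i < ?n" for i
    unfolding r_def using that bij by (intro the_inv_into_f_f) (auto simp: bij_betw_def)
  have adj: "adj_mat M $$ (i, j) \<in> A" if "i < ?n" "j < ?n" for i j
    using that M assms(1)
    by (auto simp: adj_mat_def cofactor_def mat_delete_def M_def
        intro!: mult_mem power_mem det_mem uminus_mem one_mem)
  have "(\<Sum>b\<in>set xs. adj_mat M $$ (r a, r b) * \<zeta> ^ (b * c)) = (if a = c then det M else 0)"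
    if ac: "a \<in> set xs" "c \<in> set xs" for a c
  proof -
    obtain i j where i: "i < ?n" "a = xs ! i" and j: "j < ?n" "c = xs ! j"
      using ac by (auto simp: in_set_conv_nth)
    have "(\<Sum>b\<in>set xs. adj_mat M $$ (r a, r b) * \<zeta> ^ (b * c))
        = (\<Sum>k<?n. adj_mat M $$ (i, k) * \<zeta> ^ (xs ! k * xs ! j))"
      using sum.reindex_bij_betw[OF bij, symmetric, of "\<lambda>b. adj_mat M $$ (r a, r b) * \<zeta> ^ (b * c)"] i j
      by (simp add: r)
    also have "\<dots> = (adj_mat M * M) $$ (i, j)"
      using i j M adj_mat(1)[OF M] by (auto simp: scalar_prod_def M_def atLeast0LessThan)
    also have "\<dots> = (if i = j then det M else 0)" using adj_mat(3)[OF M] i j by simp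
    finally show ?thesis using i j xs by (simp add: nth_eq_iff_index_eq)
  qed
  moreover have "adj_mat M $$ (r a, r b) \<in> A" if "a \<in> set xs" "b \<in> set xs" for a b
    using that r adj by (auto simp: in_set_conv_nth)
  ultimately show ?thesis unfolding nonsing_def using det unfolding M_def[symmetric]
    by (intro exI[of _ "\<lambda>a b. adj_mat M $$ (r a, r b)"] exI[of _ "det M"]) auto
qed

end

section \<open>Computing principal minors\<close>

text \<open>Integer lists of length \<open>d\<close> represent elements of \<open>\<int>[x]/(x\<^sup>d - 1)\<close>.\<close>

fun list_add :: "int list \<Rightarrow> int list \<Rightarrow> int list" where
  "list_add (x # xs) (y # ys) = (x + y) # list_add xs ys"
| "list_add [] ys = ys"
| "list_add xs [] = xs"

text \<open>Multiplication by \<open>x ^ e\<close>: the last \<open>e\<close> of the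
  \<open>d\<close> coefficients wrap around to the front.\<close>

definition cyc_shift :: "nat \<Rightarrow> nat \<Rightarrow> int list \<Rightarrow> int list" where
  "cyc_shift d e xs = drop (d - e) xs @ take (d - e) xs"

fun cyc_mult :: "nat \<Rightarrow> int list \<Rightarrow> int list \<Rightarrow> int list" where
  "cyc_mult d [] ys = []"
| "cyc_mult d (x # xs) ys = list_add (map ((*) x) ys) (cyc_shift d 1 (cyc_mult d xs ys))"

text \<open>Laplace expansion along the first row of the minor of \<open>(x^(i * j))\<close> with rows \<open>rs\<close> and columns
  \<open>us @ cs\<close>, restricted to the terms from the columns \<open>cs\<close>.\<close>

fun cyc_minor :: "nat \<Rightarrow> nat list \<Rightarrow> nat list \<Rightarrow> nat list \<Rightarrow> int list" where
  "cyc_minor d [] us cs = 1 # replicate (d - 1) 0"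
| "cyc_minor d (r # rs) us [] = []"
| "cyc_minor d (r # rs) us (c # cs) =
     list_add (cyc_shift d (r * c mod d) (cyc_minor d rs [] (us @ cs)))
       (map uminus (cyc_minor d (r # rs) (us @ [c]) cs))"

abbreviation cyc_eval :: "complex \<Rightarrow> int list \<Rightarrow> complex" where
  "cyc_eval \<equiv> horner_sum of_int"

lemma length_list_add [simp]: "length (list_add xs ys) = max (length xs) (length ys)"
  by (induction xs ys rule: list_add.induct) auto

lemma length_cyc_shift [simp]: "length (cyc_shift d e xs) = length xs"
  by (simp add: cyc_shift_def)

lemma length_cyc_mult: "length (cyc_mult d xs ys) = (if xs = [] then 0 else length ys)"
  by (induction xs) auto

lemma length_cyc_minor:
  "d > 0 \<Longrightarrow> length rs = length us + length cs \<Longrightarrow>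
    length (cyc_minor d rs us cs) = (if rs \<noteq> [] \<and> cs = [] then 0 else d)"
  by (induction d rs us cs rule: cyc_minor.induct) auto

lemma cyc_eval_list_add: "cyc_eval \<zeta> (list_add xs ys) = cyc_eval \<zeta> xs + cyc_eval \<zeta> ys"
  by (induction xs ys rule: list_add.induct) (auto simp: algebra_simps)

lemma cyc_eval_map_mult: "cyc_eval \<zeta> (map ((*) a) xs) = of_int a * cyc_eval \<zeta> xs"
  by (induction xs) (auto simp: algebra_simps)

lemma cyc_eval_map_uminus: "cyc_eval \<zeta> (map uminus xs) = - cyc_eval \<zeta> xs"
  by (induction xs) (auto simp: algebra_simps)

lemma cyc_eval_replicate_0: "cyc_eval \<zeta> (replicate n 0) = 0"
  by (induction n) auto

lemma cyc_eval_shift: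
  assumes "\<zeta> ^ d = 1" "length xs = d \<or> xs = []" "e \<le> d"
  shows "cyc_eval \<zeta> (cyc_shift d e xs) = \<zeta> ^ e * cyc_eval \<zeta> xs"
proof (cases "xs = []")
  case False
  have "cyc_eval \<zeta> xs = cyc_eval \<zeta> (take (d - e) xs @ drop (d - e) xs)" by simp
  also have "\<dots> = cyc_eval \<zeta> (take (d - e) xs) + \<zeta> ^ (d - e) * cyc_eval \<zeta> (drop (d - e) xs)"
    unfolding horner_sum_append using False assms by simp
  also have "\<zeta> ^ e * \<dots> = \<zeta> ^ e * cyc_eval \<zeta> (take (d - e) xs)
      + (\<zeta> ^ e * \<zeta> ^ (d - e)) * cyc_eval \<zeta> (drop (d - e) xs)"
    by (simp add: algebra_simps)
  also have "\<zeta> ^ e * \<zeta> ^ (d - e) = 1"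
    using assms by (simp flip: power_add)
  finally show ?thesis
    unfolding cyc_shift_def horner_sum_append using False assms by (simp add: add.commute)
qed (simp add: cyc_shift_def)

lemma cyc_eval_mult:
  assumes "\<zeta> ^ d = 1" "length ys = d" "d > 0"
  shows "cyc_eval \<zeta> (cyc_mult d xs ys) = cyc_eval \<zeta> xs * cyc_eval \<zeta> ys"
proof (induction xs)
  case (Cons x xs)
  have "cyc_eval \<zeta> (cyc_shift d 1 (cyc_mult d xs ys)) = \<zeta> ^ 1 * cyc_eval \<zeta> (cyc_mult d xs ys)"
    using assms length_cyc_mult[of d xs ys] by (intro cyc_eval_shift) (auto split: if_splits)
  then show ?case
    using Cons by (simp add: cyc_eval_list_add cyc_eval_map_mult algebra_simps)
qed simp

definition fourier_block :: "complex \<Rightarrow> nat list \<Rightarrow> nat list \<Rightarrow> complex mat" where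
  "fourier_block \<zeta> rs cs = mat (length rs) (length rs) (\<lambda>(i, j). \<zeta> ^ (rs ! i * cs ! j))"

lemma det_fourier_block_Cons:
  assumes "Suc (length rs) = length cs"
  shows "det (fourier_block \<zeta> (r # rs) cs) =
    (\<Sum>j<length cs. (- 1) ^ j * \<zeta> ^ (r * cs ! j) * det (fourier_block \<zeta> rs (take j cs @ drop (Suc j) cs)))"
proof -
  have "det (fourier_block \<zeta> (r # rs) cs) = (\<Sum>j<Suc (length rs).
      fourier_block \<zeta> (r # rs) cs $$ (0, j) * cofactor (fourier_block \<zeta> (r # rs) cs) 0 j)"
    by (rule laplace_expansion_row) (auto simp: fourier_block_def)
  also have "\<dots> = (\<Sum>j<Suc (length rs). (- 1) ^ j * \<zeta> ^ (r * cs ! j)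
      * det (fourier_block \<zeta> rs (take j cs @ drop (Suc j) cs)))"
  proof (rule sum.cong)
    fix j assume j: "j \<in> {..<Suc (length rs)}"
    have "mat_delete (fourier_block \<zeta> (r # rs) cs) 0 j = fourier_block \<zeta> rs (take j cs @ drop (Suc j) cs)"
      using j assms by (intro eq_matI) (auto simp: mat_delete_def fourier_block_def nth_append min_def)
    then show "fourier_block \<zeta> (r # rs) cs $$ (0, j) * cofactor (fourier_block \<zeta> (r # rs) cs) 0 j
      = (- 1) ^ j * \<zeta> ^ (r * cs ! j) * det (fourier_block \<zeta> rs (take j cs @ drop (Suc j) cs))"
      using j by (simp add: cofactor_def) (simp add: fourier_block_def)
  qed simp
  finally show ?thesis using assms by simp
qed

text \<open>Signs are counted from the head of \<open>cs\<close>, whatever the length of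
  \<open>us\<close>. Moving a column from \<open>cs\<close> to \<open>us\<close> shifts this count
  by one, which the negation in the recursion makes up for.\<close>

lemma cyc_eval_minor_aux:
  assumes "\<zeta> ^ d = 1" "d > 0" "length rs = length us + length cs"
  shows "cyc_eval \<zeta> (cyc_minor d rs us cs) = (case rs of [] \<Rightarrow> 1 | r # rs' \<Rightarrow>
    (\<Sum>j<length cs. (- 1) ^ j * \<zeta> ^ (r * cs ! j)
        * det (fourier_block \<zeta> rs' (us @ take j cs @ drop (Suc j) cs))))"
  using assms
proof (induction d rs us cs rule: cyc_minor.induct)
  case (1 d us cs)
  then show ?case by (simp add: cyc_eval_replicate_0)
next
  case (2 d r rs us)
  then show ?case by simp
next
  case (3 d r rs us c cs)
  have "cyc_eval \<zeta> (cyc_minor d rs [] (us @ cs)) = det (fourier_block \<zeta> rs (us @ cs))"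
  proof (cases rs)
    case Nil
    then show ?thesis by (simp add: cyc_eval_replicate_0 fourier_block_def)
  next
    case (Cons r' rs')
    then show ?thesis using 3 by (simp add: det_fourier_block_Cons)
  qed
  moreover have "cyc_eval \<zeta> (cyc_shift d (r * c mod d) (cyc_minor d rs [] (us @ cs)))
      = \<zeta> ^ (r * c) * cyc_eval \<zeta> (cyc_minor d rs [] (us @ cs))"
    using 3 length_cyc_minor[of d rs "[]" "us @ cs"] power_mod_order[of \<zeta> d "r * c"]
    by (subst cyc_eval_shift) (auto split: if_splits simp: less_imp_le)
  moreover have "cyc_eval \<zeta> (cyc_minor d (r # rs) (us @ [c]) cs)
     = (\<Sum>j<length cs. (- 1) ^ j * \<zeta> ^ (r * cs ! j) * det (fourier_block \<zeta> rs (us @ c # take j cs @ drop (Suc j) cs)))"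
    using 3 by simp
  ultimately show ?case
    by (simp add: cyc_eval_list_add cyc_eval_map_uminus sum.lessThan_Suc_shift sum_negf del: sum.lessThan_Suc)
qed

lemma cyc_eval_minor:
  assumes "\<zeta> ^ d = 1" "d > 0" "length rs = length cs"
  shows "cyc_eval \<zeta> (cyc_minor d rs [] cs) = det (fourier_block \<zeta> rs cs)"
proof (cases rs)
  case Nil
  then show ?thesis by (simp add: cyc_eval_replicate_0 fourier_block_def)
next
  case (Cons r rs')
  then show ?thesis using assms cyc_eval_minor_aux[of \<zeta> d rs "[]" cs]
    by (simp add: det_fourier_block_Cons)
qed

section \<open>Norms of cyclotomic integers modulo p\<close>

definition mod_mult :: "nat \<Rightarrow> nat \<Rightarrow> int list \<Rightarrow> int list \<Rightarrow> int list" where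
  "mod_mult p d xs ys = map (\<lambda>x. x mod int p) (cyc_mult d xs ys)"

text \<open>For \<open>u\<close> prime to \<open>d\<close> this substitutes \<open>x ^ v\<close> for
  \<open>x\<close>, where \<open>v\<close> is the inverse of \<open>u\<close> modulo
  \<open>d\<close>.\<close>

definition galois :: "nat \<Rightarrow> nat \<Rightarrow> int list \<Rightarrow> int list" where
  "galois d u xs = map (\<lambda>k. xs ! (k * u mod d)) [0..<d]"

text \<open>The product of all Galois conjugates. That \<open>galois\<close> is a homomorphism is never needed: the result
  only has to be some multiple of \<open>z\<close>.\<close>

definition norm11 :: "int list \<Rightarrow> int list" where
  "norm11 z = (let w = mod_mult 13 11 z (galois 11 10 z); a = mod_mult 13 11 w (galois 11 2 w);
     b = mod_mult 13 11 a (galois 11 4 a) in mod_mult 13 11 b (galois 11 5 w))"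

text \<open>The units modulo \<open>10\<close> are \<open>1, 9, 3, 7\<close>: \<open>w\<close>
  covers the first two and its conjugate the others. In \<open>norm11\<close>, \<open>w\<close>
  covers a pair of opposite units, and \<open>1, 2, 4, 8, 5\<close> represent the units modulo
  \<open>11\<close> up to sign; \<open>b\<close> collects the first four and the last factor adds
  \<open>5\<close>.\<close>

definition norm10 :: "int list \<Rightarrow> int list" where
  "norm10 z = (let w = mod_mult 7 10 z (galois 10 9 z) in mod_mult 7 10 w (galois 10 3 w))"

context residue_ring_at_p begin

lemma cyc_eval_mem: "\<zeta> \<in> A \<Longrightarrow> cyc_eval \<zeta> xs \<in> A"
  by (induction xs) (auto intro!: mem_intros)

lemma cyc_eval_mod_cong: "\<zeta> \<in> A \<Longrightarrow> cyc_eval \<zeta> (map (\<lambda>x. x mod int p) xs) \<approx> cyc_eval \<zeta> xs"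
  by (induction xs) (auto intro!: cong_eta_add cong_eta_mult_left of_int_mod_cong)

text \<open>Reducing coefficients modulo \<open>p\<close> does not change the residue, so the first
  factor divides a unit.\<close>

lemma res_unit_mod_multD:
  assumes "res_unit (cyc_eval \<zeta> (mod_mult p d xs ys))"
    and "\<zeta> \<in> A" "\<zeta> ^ d = 1" "d > 0" "length ys = d"
  shows "res_unit (cyc_eval \<zeta> xs)"
proof -
  have "cyc_eval \<zeta> (mod_mult p d xs ys) \<approx> cyc_eval \<zeta> xs * cyc_eval \<zeta> ys"
    using cyc_eval_mod_cong[OF assms(2), of "cyc_mult d xs ys"] cyc_eval_mult[OF assms(3,5,4), of xs]
    by (simp add: mod_mult_def)
  then have "res_unit (cyc_eval \<zeta> xs * cyc_eval \<zeta> ys)"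
    using res_unit_cong assms by (blast intro: mult_mem cyc_eval_mem)
  then show ?thesis using res_unit_factor assms cyc_eval_mem by blast
qed

lemma length_galois: "length (galois d u xs) = d" by (simp add: galois_def)

text \<open>Every product in \<open>norm11\<close> has a conjugate as its right factor; peeling
  these off one after another leads from the norm back to \<open>z\<close>.\<close>

lemma res_unit_norm11D:
  assumes "res_unit (cyc_eval \<zeta> (norm11 z))" "p = 13" "\<zeta> \<in> A" "\<zeta> ^ 11 = 1"
  shows "res_unit (cyc_eval \<zeta> z)"
proof -
  have D: "res_unit (cyc_eval \<zeta> xs)"
    if "res_unit (cyc_eval \<zeta> (mod_mult 13 11 xs (galois 11 u ys)))" for xs u ys
    using res_unit_mod_multD[of \<zeta> 11 xs "galois 11 u ys"] that assms length_galois by simp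
  show ?thesis using assms(1) by (auto simp: norm11_def Let_def dest!: D)
qed

lemma res_unit_norm10D:
  assumes "res_unit (cyc_eval \<zeta> (norm10 z))" "p = 7" "\<zeta> \<in> A" "\<zeta> ^ 10 = 1"
  shows "res_unit (cyc_eval \<zeta> z)"
proof -
  have D: "res_unit (cyc_eval \<zeta> xs)"
    if "res_unit (cyc_eval \<zeta> (mod_mult 7 10 xs (galois 10 u ys)))" for xs u ys
    using res_unit_mod_multD[of \<zeta> 10 xs "galois 10 u ys"] that assms length_galois by simp
  show ?thesis using assms(1) by (auto simp: norm10_def Let_def dest!: D)
qed

end

section \<open>Primitive roots and the finite check of index sets\<close>

definition primitive_root :: "nat \<Rightarrow> complex \<Rightarrow> bool" where
  "primitive_root d \<zeta> \<longleftrightarrow> \<zeta> ^ d = 1 \<and> (\<forall>k. 0 < k \<and> k < d \<longrightarrow> \<zeta> ^ k \<noteq> 1)"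

lemma primitive_root_power:
  assumes "primitive_root d \<zeta>" "coprime u d" "d > 0"
  shows "primitive_root d (\<zeta> ^ u)"
  unfolding primitive_root_def
proof (intro conjI allI impI)
  have d1: "\<zeta> ^ d = 1" using assms by (simp add: primitive_root_def)
  then show "(\<zeta> ^ u) ^ d = 1" by (metis mult.commute power_mult power_one)
  fix k assume k: "0 < k \<and> k < d"
  have "\<not> d dvd u * k"
    using k assms(2) by (metis coprime_commute coprime_dvd_mult_right_iff nat_dvd_not_less)
  then have "0 < u * k mod d" "u * k mod d < d" using assms(3) by (auto simp: mod_greater_zero_iff_not_dvd)
  then have "\<zeta> ^ (u * k mod d) \<noteq> 1" using assms(1) by (auto simp: primitive_root_def)
  then show "(\<zeta> ^ u) ^ k \<noteq> 1" using power_mod_order[OF d1] by (simp add: power_mult)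
qed

text \<open>The norm of an element to \<open>\<rat>\<close>, reduced modulo the cyclotomic polynomial, is a constant; it is
  tested for not vanishing modulo \<open>p\<close>.\<close>

definition pass11 :: "int list \<Rightarrow> bool" where
  "pass11 N = (case N of n0 # n1 # ns \<Rightarrow> ns = replicate 9 n1 \<and> (n0 - n1) mod 13 \<noteq> 0 | _ \<Rightarrow> False)"

text \<open>The primitive tenth roots of unity sum to \<open>1\<close> and the primitive fifth roots
  to \<open>-1\<close>, while \<open>x ^ 5\<close> becomes \<open>-1\<close>. With coefficients
  constant on these classes the value is \<open>n0 - n5 + n1 - n2\<close>.\<close>

definition pass10 :: "int list \<Rightarrow> bool" where
  "pass10 N = (case N of [n0, n1, n2, n3, n4, n5, n6, n7, n8, n9] \<Rightarrow>
     n3 = n1 \<and> n7 = n1 \<and> n9 = n1 \<and> n4 = n2 \<and> n6 = n2 \<and> n8 = n2 \<and> (n0 - n5 + n1 - n2) mod 7 \<noteq> 0 | _ \<Rightarrow> False)"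

definition ok11 :: "nat list \<Rightarrow> bool" where
  "ok11 l = pass11 (norm11 (cyc_minor 11 l [] l))"

definition ok10 :: "nat list \<Rightarrow> bool" where
  "ok10 l = pass10 (norm10 (cyc_minor 10 l [] l))"

definition cyc_diff :: "nat \<Rightarrow> nat \<Rightarrow> nat \<Rightarrow> nat" where
  "cyc_diff d x y = (if y \<le> x then x - y else x + d - y)"

text \<open>Affine images of an index set have the same minors up to roots of unity and Galois
  conjugation, so only sets whose element sum is minimal among their translates and reflections
  containing \<open>0\<close> need to be computed.\<close>

fun reducible :: "nat \<Rightarrow> nat list \<Rightarrow> nat list \<Rightarrow> bool" where
  "reducible d l [] = False"
| "reducible d l (y # ys) =
    (if sum_list (map (\<lambda>x. cyc_diff d x y) l) < sum_list l then True
     else if sum_list (map (\<lambda>x. cyc_diff d y x) l) < sum_list l then True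
     else reducible d l ys)"

text \<open>The accumulator \<open>us\<close> holds the elements chosen so far and \<open>n\<close>
  bounds how many may follow; \<open>P\<close> is tested at the leaves without building a list of
  subsequences.\<close>

fun all_subseqs :: "('a list \<Rightarrow> bool) \<Rightarrow> nat \<Rightarrow> 'a list \<Rightarrow> 'a list \<Rightarrow> bool" where
  "all_subseqs P n us [] = P us"
| "all_subseqs P 0 us (x # xs) = P us"
| "all_subseqs P (Suc n) us (x # xs) = (all_subseqs P n (us @ [x]) xs \<and> all_subseqs P (Suc n) us xs)"

lemma all_subseqsD:
  "all_subseqs P n us xs \<Longrightarrow> ys \<in> set (subseqs xs) \<Longrightarrow> length ys \<le> n \<Longrightarrow> P (us @ ys)"
  by (induction P n us xs arbitrary: ys rule: all_subseqs.induct) (force simp: Let_def)+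

definition reducible_or_ok :: "(nat list \<Rightarrow> bool) \<Rightarrow> nat \<Rightarrow> nat list \<Rightarrow> bool" where
  "reducible_or_ok ok d l = (if reducible d l l then True else ok l)"

text \<open>Four elements besides \<open>0\<close> give all index sets through \<open>0\<close> of
  size at most \<open>5\<close>.\<close>

lemma all_ok_10: "all_subseqs (reducible_or_ok ok10 10) 4 [0] [1..<10]"
  by code_simp

lemma all_ok_11: "all_subseqs (reducible_or_ok ok11 11) 4 [0] [1..<11]"
  by code_simp

lemma cyc_diff_less: "x < d \<Longrightarrow> y < d \<Longrightarrow> cyc_diff d x y < d"
  by (auto simp: cyc_diff_def)

lemma cyc_diff_translate: "x < d \<Longrightarrow> y < d \<Longrightarrow> (1 * cyc_diff d x y + y) mod d = x"
  by (auto simp: cyc_diff_def)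

text \<open>The factor \<open>d - 1\<close> represents \<open>-1\<close> modulo
  \<open>d\<close>.\<close>

lemma cyc_diff_reflect:
  assumes "x < d" "y < d" shows "((d - 1) * cyc_diff d y x + y) mod d = x"
proof -
  define k where "k = cyc_diff d y x"
  have "k + x = y \<or> k + x = y + d" using assms by (auto simp: k_def cyc_diff_def)
  moreover have "(d - 1) * k + k = d * k" using assms by (cases d) auto
  ultimately have "(d - 1) * k + y = x + d * k \<or> (d - 1) * k + y + d = x + d * k"
    by linarith
  then have "((d - 1) * k + y) mod d = x mod d"
    by (metis mod_add_self2 mod_mult_self2)
  then show ?thesis using assms by (simp add: k_def)
qed

lemma reducibleD:
  "reducible d l ys \<Longrightarrow> \<exists>y\<in>set ys. sum_list (map (\<lambda>x. cyc_diff d x y) l) < sum_list l \<or>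
     sum_list (map (\<lambda>x. cyc_diff d y x) l) < sum_list l"
  by (induction d l ys rule: reducible.induct) (auto split: if_splits)

lemma coprime_pred: "0 < d \<Longrightarrow> coprime (d - 1) d" for d :: nat
  by (metis One_nat_def Suc_pred coprime_Suc_right_nat coprime_commute)

context residue_ring_at_p begin

lemma nonsing_affine_preimage:
  assumes inv: "\<And>x. x \<in> S \<Longrightarrow> (u * h x + t) mod d = x"
    and "nonsing (\<zeta> ^ (u * u)) (h ` S)" "\<zeta> \<in> A" "\<zeta> ^ d = 1" "d > 0"
  shows "nonsing \<zeta> S"
proof -
  have "inj_on (\<lambda>x. (u * x + t) mod d) (h ` S)"
    by (rule inj_onI) (use inv in fastforce)
  moreover have "(\<lambda>x. (u * x + t) mod d) ` (h ` S) = S"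
    using inv by (force simp: image_iff)
  ultimately show ?thesis using nonsing_affine_image[of \<zeta> u "h ` S" t d] assms by simp
qed

text \<open>Induction on the sum of the elements: a reducible set is an affine image of a set
  through \<open>0\<close> with smaller sum. The root varies in the induction because an affine map
  replaces \<open>\<zeta>\<close> by \<open>\<zeta> ^ (u * u)\<close>.\<close>

lemma nonsing_small_with_0:
  assumes ok: "\<And>\<zeta> l. \<zeta> \<in> A \<Longrightarrow> primitive_root d \<zeta> \<Longrightarrow> distinct l \<Longrightarrow> ok l \<Longrightarrow> nonsing \<zeta> (set l)"
    and check: "all_subseqs (reducible_or_ok ok d) 4 [0] [1..<d]" and d: "d > 0"
    and "\<zeta> \<in> A" "primitive_root d \<zeta>" "S \<subseteq> {..<d}" "0 \<in> S" "card S \<le> 5"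
  shows "nonsing \<zeta> S"
  using assms(4-)
proof (induction "\<Sum>S" arbitrary: S \<zeta> rule: less_induct)
  case less
  note \<zeta> = less.prems(1,2) and S = less.prems(3-)
  have \<zeta>d: "\<zeta> ^ d = 1" using \<zeta> by (simp add: primitive_root_def)
  have "S - {0} \<in> set ` set (subseqs [1..<d])"
    unfolding subseqs_powset using S by auto
  then obtain l where l: "l \<in> set (subseqs [1..<d])" "set l = S - {0}" by force
  have dist: "distinct (0 # l)" using subseqs_distinctD[OF l(1)] l(2) by simp
  have set: "set (0 # l) = S" using l(2) S by auto
  have fin: "finite S" using S finite_subset by blast
  then have "length l = card S - 1"
    using distinct_card[of l] dist l(2) S by simp
  then have "reducible_or_ok ok d ([0] @ l)"
    using S l by (intro all_subseqsD[OF check]) auto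
  then consider "ok (0 # l)" | "reducible d (0 # l) (0 # l)"
    by (auto simp: reducible_or_ok_def simp del: reducible.simps split: if_splits)
  then show ?case
  proof cases
    case 1
    then show ?thesis using ok[OF \<zeta> dist] set by simp
  next
    case 2
    \<comment> \<open>Used with \<open>u = 1\<close> for translates and \<open>u = d - 1\<close> for
      reflections.\<close>
    have step: "nonsing \<zeta> S"
      if h: "\<And>x. x \<in> S \<Longrightarrow> (u * h x + t) mod d = x" "\<And>x. x \<in> S \<Longrightarrow> h x < d" "0 \<in> h ` S"
        and u: "coprime u d" and sum: "sum_list (map h (0 # l)) < sum_list (0 # l)" for h u t
    proof (rule nonsing_affine_preimage[OF h(1) _ \<zeta>(1) \<zeta>d d])
      have "inj_on h S" by (rule inj_onI) (metis h(1))
      then have "\<Sum>(h ` S) = sum h S" by (simp add: sum.reindex)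
      also have "\<dots> = sum_list (map h (0 # l))"
        using sum_list_distinct_conv_sum_set[OF dist, of h] set by simp
      also have "\<dots> < \<Sum>S"
        using sum sum_list_distinct_conv_sum_set[OF dist, of "\<lambda>x. x"] set by simp
      finally have less_sum: "\<Sum>(h ` S) < \<Sum>S" .
      show "nonsing (\<zeta> ^ (u * u)) (h ` S)"
      proof (rule less.hyps[OF less_sum])
        show "\<zeta> ^ (u * u) \<in> A" using \<zeta> by (intro power_mem)
        show "primitive_root d (\<zeta> ^ (u * u))" using \<zeta> u d by (intro primitive_root_power) auto
        show "h ` S \<subseteq> {..<d}" "0 \<in> h ` S" using h by auto
        show "card (h ` S) \<le> 5" using card_image_le[OF fin, of h] S by linarith
      qed
    qed
    obtain y where y: "y \<in> S" and
      red: "sum_list (map (\<lambda>x. cyc_diff d x y) (0 # l)) < sum_list (0 # l) \<or>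
       sum_list (map (\<lambda>x. cyc_diff d y x) (0 # l)) < sum_list (0 # l)"
      using reducibleD[OF 2] unfolding set by blast
    have "0 \<in> (\<lambda>x. cyc_diff d x y) ` S" "0 \<in> (\<lambda>x. cyc_diff d y x) ` S"
      using y by (auto intro!: image_eqI[of _ _ y] simp: cyc_diff_def)
    moreover have "x < d" if "x \<in> S" for x using that S by auto
    ultimately show ?thesis
      using red step[of 1 "\<lambda>x. cyc_diff d x y" y] step[of "d - 1" "\<lambda>x. cyc_diff d y x" y]
        cyc_diff_translate[of _ d y] cyc_diff_reflect[of _ d y] cyc_diff_less y coprime_pred[OF d]
      by (metis coprime_1_left)
  qed
qed

text \<open>As \<open>d \<le> 11\<close>, either \<open>S\<close> or its complement has at most
  \<open>5\<close> elements, and a nonempty small set can be translated so as to contain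
  \<open>0\<close>.\<close>

lemma nonsing_of_check:
  assumes ok: "\<And>\<zeta> l. \<zeta> \<in> A \<Longrightarrow> primitive_root d \<zeta> \<Longrightarrow> distinct l \<Longrightarrow> ok l \<Longrightarrow> nonsing \<zeta> (set l)"
    and check: "all_subseqs (reducible_or_ok ok d) 4 [0] [1..<d]" and d: "1 < d" "d \<le> 11" "\<not> p dvd d"
    and \<zeta>: "\<zeta> \<in> A" "primitive_root d \<zeta>" and S: "S \<subseteq> {..<d}"
  shows "nonsing \<zeta> S"
proof -
  have small: "nonsing \<xi> T" if \<xi>: "\<xi> \<in> A" "primitive_root d \<xi>" and T: "T \<subseteq> {..<d}" "card T \<le> 5" for \<xi> T
  proof (cases "T = {}")
    case False
    then obtain t where t: "t \<in> T" by blast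
    have fin: "finite T" using T finite_subset by blast
    let ?h = "\<lambda>x. cyc_diff d x t"
    have "nonsing \<xi> (?h ` T)"
    proof (rule nonsing_small_with_0[OF ok check])
      show "card (?h ` T) \<le> 5" using card_image_le[OF fin, of ?h] T by linarith
      show "0 \<in> ?h ` T" using t by (auto intro!: image_eqI[of _ _ t] simp: cyc_diff_def)
      show "?h ` T \<subseteq> {..<d}" using cyc_diff_less[of _ d t] T t by auto
    qed (use \<xi> d in auto)
    then show ?thesis
      using \<xi> T t d cyc_diff_translate[of _ d t]
      by (intro nonsing_affine_preimage[of T 1 ?h t d]) (auto simp: primitive_root_def)
  qed (simp add: nonsing_empty)
  show ?thesis
  proof (cases "card S \<le> 5")
    case False
    have "card ({..<d} - S) = d - card S"
      using card_Diff_subset[of S "{..<d}"] S finite_subset[OF S] by simp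
    then have "card ({..<d} - S) \<le> 5" using False d by simp
    \<comment> \<open>The complementary minor belongs to the inverse Fourier matrix, hence the root
      \<open>\<zeta> ^ (d - 1)\<close>, the inverse of \<open>\<zeta>\<close>.\<close>
    then have "nonsing (\<zeta> ^ (d - 1)) ({..<d} - S)"
      using \<zeta> d coprime_pred by (intro small primitive_root_power power_mem) auto
    moreover have "\<zeta> ^ (d - 1) * \<zeta> = 1"
      using \<zeta>(2) d by (simp add: primitive_root_def flip: power_Suc2)
    moreover have prim: "\<zeta> ^ k \<noteq> 1" if "0 < k" "k < d" for k
      using \<zeta>(2) that unfolding primitive_root_def by blast
    moreover have "\<zeta> ^ d = 1" using \<zeta>(2) unfolding primitive_root_def by blast
    ultimately show ?thesis
      by (intro nonsing_complement[OF prim \<zeta>(1) _ power_mem[OF \<zeta>(1)] _ d(3) S]) assumption+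
  qed (use small \<zeta> S in auto)
qed

lemma nonsing_of_cyc_minor:
  assumes "\<zeta> \<in> A" "\<zeta> ^ d = 1" "d > 0" "distinct l" "res_unit (cyc_eval \<zeta> (cyc_minor d l [] l))"
  shows "nonsing \<zeta> (set l)"
  using nonsing_of_det[OF assms(1,4)] assms(5) cyc_eval_minor[OF assms(2,3), of l l]
  by (simp add: fourier_block_def)

text \<open>Subtracting \<open>n1\<close> times the vanishing sum of all powers of
  \<open>\<zeta>\<close> leaves the integer \<open>n0 - n1\<close>.\<close>

lemma res_unit_pass11:
  assumes "pass11 N" "p = 13" "primitive_root 11 \<zeta>" shows "res_unit (cyc_eval \<zeta> N)"
proof -
  obtain n0 n1 where N: "N = n0 # n1 # replicate 9 n1" and n: "(n0 - n1) mod 13 \<noteq> 0"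
    using assms(1) unfolding pass11_def by (cases N; cases "tl N") auto
  have "\<zeta> ^ 11 = 1" "\<zeta> ^ 1 \<noteq> 1" using assms(3) unfolding primitive_root_def by auto
  then have s: "(\<Sum>k<11. \<zeta> ^ k) = 0" using geometric_sum[of \<zeta> 11] by simp
  have "cyc_eval \<zeta> N = of_int (n0 - n1) + of_int n1 * (\<Sum>k<11. \<zeta> ^ k)"
    unfolding N by (simp add: numeral_eq_Suc algebra_simps)
  then have "cyc_eval \<zeta> N = of_int (n0 - n1)" by (simp add: s)
  moreover have "\<not> int p dvd n0 - n1" using n assms(2) by (simp add: dvd_eq_mod_eq_0)
  ultimately show ?thesis using res_unit_of_int by metis
qed

lemma res_unit_pass10:
  assumes "pass10 N" "p = 7" "primitive_root 10 \<zeta>" shows "res_unit (cyc_eval \<zeta> N)"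
proof -
  obtain n0 n1 n2 n5 where N: "N = [n0, n1, n2, n1, n2, n5, n2, n1, n2, n1]"
    and n: "(n0 - n5 + n1 - n2) mod 7 \<noteq> 0"
    using assms(1) by (auto simp: pass10_def split: list.splits)
  have r: "\<zeta> ^ 10 = 1" "\<zeta> ^ 5 \<noteq> 1" "\<zeta> ^ 2 \<noteq> 1" using assms(3) unfolding primitive_root_def by auto
  have "(\<zeta> ^ 5 - 1) * (\<zeta> ^ 5 + 1) = 0" using r(1) by (simp add: algebra_simps flip: power_add)
  then have z5: "\<zeta> ^ 5 + 1 = 0" using r(2) by simp
  have "\<zeta> + 1 \<noteq> 0" using r(3) by (auto simp: add_eq_0_iff2)
  moreover have "(\<zeta> + 1) * (\<zeta> ^ 4 - \<zeta> ^ 3 + \<zeta> ^ 2 - \<zeta> + 1) = \<zeta> ^ 5 + 1"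
    by (simp add: algebra_simps numeral_eq_Suc)
  ultimately have z4: "\<zeta> ^ 4 - \<zeta> ^ 3 + \<zeta> ^ 2 - \<zeta> + 1 = 0" using z5 by simp
  \<comment> \<open>Explicit division by the two vanishing polynomials \<open>x ^ 5 + 1\<close> and
    the tenth cyclotomic polynomial, with an integer remainder.\<close>
  have "cyc_eval \<zeta> N = of_int (n0 - n5 + n1 - n2)
      + (of_int n2 - of_int n1) * (\<zeta> ^ 4 - \<zeta> ^ 3 + \<zeta> ^ 2 - \<zeta> + 1)
      + (of_int n5 + of_int n1 * (\<zeta> ^ 2 + \<zeta> ^ 4) + of_int n2 * (\<zeta> + \<zeta> ^ 3)) * (\<zeta> ^ 5 + 1)"
    unfolding N by (simp add: numeral_eq_Suc algebra_simps)
  then have "cyc_eval \<zeta> N = of_int (n0 - n5 + n1 - n2)" unfolding z4 z5 by simp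
  moreover have "\<not> int p dvd n0 - n5 + n1 - n2" using n assms(2) by (simp add: dvd_eq_mod_eq_0)
  ultimately show ?thesis using res_unit_of_int by metis
qed

lemma nonsing_7:
  assumes "p = 7" "\<zeta> \<in> A" "primitive_root 10 \<zeta>" "S \<subseteq> {..<10}" shows "nonsing \<zeta> S"
proof (rule nonsing_of_check[OF _ all_ok_10])
  fix \<xi> l assume \<xi>: "\<xi> \<in> A" "primitive_root 10 \<xi>" "distinct l" "ok10 l"
  then have \<xi>d: "\<xi> ^ 10 = 1" by (simp add: primitive_root_def)
  have "res_unit (cyc_eval \<xi> (norm10 (cyc_minor 10 l [] l)))"
    using \<xi> assms(1) unfolding ok10_def by (intro res_unit_pass10)
  then show "nonsing \<xi> (set l)"
    using res_unit_norm10D \<xi> \<xi>d assms(1) by (intro nonsing_of_cyc_minor[of _ 10]) auto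
qed (use assms in auto)

lemma nonsing_13:
  assumes "p = 13" "\<zeta> \<in> A" "primitive_root 11 \<zeta>" "S \<subseteq> {..<11}" shows "nonsing \<zeta> S"
proof (rule nonsing_of_check[OF _ all_ok_11])
  fix \<xi> l assume \<xi>: "\<xi> \<in> A" "primitive_root 11 \<xi>" "distinct l" "ok11 l"
  then have \<xi>d: "\<xi> ^ 11 = 1" by (simp add: primitive_root_def)
  have "res_unit (cyc_eval \<xi> (norm11 (cyc_minor 11 l [] l)))"
    using \<xi> assms(1) unfolding ok11_def by (intro res_unit_pass11)
  then show "nonsing \<xi> (set l)"
    using res_unit_norm11D \<xi> \<xi>d assms(1) by (intro nonsing_of_cyc_minor[of _ 11]) auto
qed (use assms in auto)

end

section \<open>Reduction to the Fourier matrix of order d\<close>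

context residue_ring_at_p begin

lemma eta_power_cong_1: "\<eta> ^ j \<approx> 1"
  using cong_eta_prod[of "{..<j}" "\<lambda>_. \<eta>" "\<lambda>_. 1"] eta_cong_1 eta_mem one_mem by simp

text \<open>If \<open>p\<close> did not divide \<open>s - r\<close>, a Bezout identity would make
  \<open>\<eta>\<close> a power of \<open>\<eta> ^ (s - r) = 1\<close>.\<close>

lemma eta_power_eqD:
  assumes "\<eta> ^ r = \<eta> ^ s" shows "int p dvd int r - int s"
proof -
  have p0: "p > 0" using prime_p by (simp add: prime_gt_0_nat)
  then have "\<eta> \<noteq> 0" using eta_pow by (auto simp: zero_power)
  have main: "p dvd s - r" if eq: "\<eta> ^ r = \<eta> ^ s" and le: "r \<le> s" for r s
  proof (rule ccontr)
    assume not: "\<not> p dvd s - r"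
    have 1: "\<eta> ^ (s - r) = 1" using eq le \<open>\<eta> \<noteq> 0\<close> by (simp add: power_diff)
    have "coprime (s - r) p" using not prime_p by (simp add: coprime_commute prime_imp_coprime)
    moreover have "s - r \<noteq> 0" using not by auto
    ultimately obtain x y where "(s - r) * x = p * y + 1"
      using bezout_nat[of "s - r" p] by auto
    then have "(\<eta> ^ (s - r)) ^ x = (\<eta> ^ p) ^ y * \<eta>"
      by (metis power_mult power_add power_one_right)
    then show False using 1 eta_pow eta_neq_1 by simp
  qed
  show ?thesis
  proof (cases "r \<le> s")
    case True
    then have "int p dvd int s - int r"
      using main[OF assms] by (metis int_dvd_int_iff of_nat_diff)
    then show ?thesis by (metis dvd_minus_iff minus_diff_eq)
  next
    case False
    then show ?thesis
      using main[OF assms[symmetric]] by (metis int_dvd_int_iff nat_le_linear of_nat_diff)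
  qed
qed

lemma newton_coeff_mem:
  assumes "\<And>k. k \<le> K \<Longrightarrow> x k \<in> A" "\<And>m. s m \<in> A" "k \<le> K"
  shows "newton_coeff x s k j \<in> A"
  using assms(3)
proof (induction j arbitrary: k)
  case 0
  then show ?case by (cases k) (auto intro: mem_intros)
next
  case (Suc j)
  then show ?case using assms(1,2) by (cases k) (auto intro!: add_mem mult_mem diff_mem)
qed

text \<open>When all nodes are congruent to \<open>1\<close>, the recursion for the coefficients of
  the monomials is Pascal's rule.\<close>

lemma newton_coeff_cong_binomial:
  assumes "\<And>k. k \<le> K \<Longrightarrow> x k \<in> A \<and> x k \<approx> 1" "k \<le> K"
  shows "newton_coeff x (\<lambda>_. 0) k j \<approx> of_nat (j choose k)"
  using assms(2)
proof (induction j arbitrary: k)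
  case 0
  then show ?case by (cases k) auto
next
  case (Suc j)
  have A: "newton_coeff x (\<lambda>_. 0) k j \<in> A" using Suc.prems assms(1)
    by (intro newton_coeff_mem[of K]) (auto intro: zero_mem)
  have "x k * newton_coeff x (\<lambda>_. 0) k j \<approx> 1 * of_nat (j choose k)"
    using Suc assms(1) by (intro cong_eta_mult) (auto intro: of_nat_mem)
  then show ?case
  proof (cases k)
    case (Suc k')
    then have "newton_coeff x (\<lambda>_. 0) k' j \<approx> of_nat (j choose k')" using Suc.IH Suc.prems by auto
    with \<open>x k * _ \<approx> _\<close> show ?thesis using Suc by (auto intro: cong_eta_add simp: add.commute)
  qed auto
qed

end

section \<open>Indices sorted into residue blocks\<close>

locale block_index =
  fixes d n :: nat and m :: "nat \<Rightarrow> nat" and e :: "nat \<Rightarrow> nat \<times> nat"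
  assumes e: "bij_betw e {..<n} (SIGMA a:{..<d}. {..<m a})"
begin

text \<open>In the application \<open>blk i\<close> is the residue class modulo \<open>d\<close> of
  the index and \<open>pos i\<close> its rank within that class; the rank is the level in the
  triangularity arguments.\<close>

abbreviation "blk i \<equiv> fst (e i)"
abbreviation "pos i \<equiv> snd (e i)"

lemma blk_less: "i < n \<Longrightarrow> blk i < d" and pos_less: "i < n \<Longrightarrow> pos i < m (blk i)"
proof -
  assume "i < n"
  then have "e i \<in> (SIGMA a:{..<d}. {..<m a})" using bij_betwE[OF e] by blast
  then show "blk i < d" "pos i < m (blk i)" by (auto simp: mem_Sigma_iff split: prod.splits)
qed

lemma index_eqI: "i < n \<Longrightarrow> j < n \<Longrightarrow> blk i = blk j \<Longrightarrow> pos i = pos j \<Longrightarrow> i = j"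
  using e by (auto simp: bij_betw_def inj_on_def prod_eq_iff)

lemma sum_index: "(\<Sum>l<n. h (blk l) (pos l)) = (\<Sum>a<d. \<Sum>k<m a. h a k)"
  for h :: "nat \<Rightarrow> nat \<Rightarrow> 'b :: comm_monoid_add"
proof -
  have "(\<Sum>l<n. h (blk l) (pos l)) = (\<Sum>q\<in>(SIGMA a:{..<d}. {..<m a}). h (fst q) (snd q))"
    by (rule sum.reindex_bij_betw[OF e])
  then show ?thesis by (simp add: sum.Sigma split_def)
qed

lemma sum_index_block:
  fixes g :: "nat \<Rightarrow> 'b :: comm_monoid_add"
  assumes "a < d" "K < m a"
  shows "(\<Sum>l<n. if blk l = a \<and> pos l \<le> K then g (pos l) else 0) = (\<Sum>k\<le>K. g k)"
proof -
  have "(\<Sum>l<n. if blk l = a \<and> pos l \<le> K then g (pos l) else 0)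
      = (\<Sum>b<d. \<Sum>k<m b. if b = a \<and> k \<le> K then g k else 0)"
    by (rule sum_index)
  also have "\<dots> = (\<Sum>b<d. if b = a then \<Sum>k<m a. if k \<le> K then g k else 0 else 0)"
    by (intro sum.cong) auto
  also have "\<dots> = (\<Sum>k<m a. if k \<le> K then g k else 0)" using assms by simp
  also have "\<dots> = (\<Sum>k\<le>K. g k)"
    using assms by (intro sum.mono_neutral_cong_right) auto
  finally show ?thesis .
qed

lemma sum_index_level:
  fixes g :: "nat \<Rightarrow> 'b :: comm_monoid_add"
  shows "(\<Sum>l<n. if pos l = K then g (blk l) else 0) = (\<Sum>b | b < d \<and> K < m b. g b)"
proof -
  have "(\<Sum>l<n. if pos l = K then g (blk l) else 0) = (\<Sum>b<d. \<Sum>k<m b. if k = K then g b else 0)"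
    by (rule sum_index)
  also have "\<dots> = (\<Sum>b<d. if K < m b then g b else 0)"
    by (intro sum.cong) auto
  also have "\<dots> = (\<Sum>b | b < d \<and> K < m b. g b)"
    by (rule sum.mono_neutral_cong_right) auto
  finally show ?thesis .
qed

text \<open>Values of the Newton basis polynomials at the nodes: block diagonal, with a triangular
  matrix in each block.\<close>

definition newton_matrix :: "(nat \<Rightarrow> nat \<Rightarrow> complex) \<Rightarrow> nat \<Rightarrow> nat \<Rightarrow> complex" where
  "newton_matrix y i l = (if blk l = blk i \<and> pos l \<le> pos i
     then \<Prod>t<pos l. y (blk i) (pos i) - y (blk i) t else 0)"

text \<open>The matrix is level triangular for \<open>pos\<close>, and inside one level diagonal.
  The result is the product of the Vandermonde determinants of the blocks.\<close>

lemma det_newton_matrix: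
  "det (mat n n (\<lambda>(i, j). newton_matrix y i j)) = (\<Prod>i<n. \<Prod>t<pos i. y (blk i) (pos i) - y (blk i) t)"
proof -
  have "det (mat n n (\<lambda>(i, j). newton_matrix y i j))
      = det (mat n n (\<lambda>(i, j). if pos i = pos j then newton_matrix y i j else 0))"
    by (rule det_level_triangular) (auto simp: newton_matrix_def)
  also have "mat n n (\<lambda>(i, j). if pos i = pos j then newton_matrix y i j else 0)
      = mat n n (\<lambda>(i, j). if i = j then \<Prod>t<pos i. y (blk i) (pos i) - y (blk i) t else 0)"
    using index_eqI by (intro eq_matI) (auto simp: newton_matrix_def)
  finally show ?thesis by (simp add: det_diagonal_fun)
qed

text \<open>Newton interpolation inside the block of \<open>i\<close>; the weight \<open>w\<close>,
  being constant on blocks, passes through it.\<close>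

lemma sum_newton_matrix:
  assumes "i < n"
  shows "(\<Sum>l<n. newton_matrix y i l * (w (blk l) * newton_coeff (y (blk l)) s (pos l) j))
     = w (blk i) * (\<Prod>t<j. y (blk i) (pos i) - s t)"
proof -
  let ?g = "\<lambda>k. w (blk i) * (newton_coeff (y (blk i)) s k j * (\<Prod>t<k. y (blk i) (pos i) - y (blk i) t))"
  have "(\<Sum>l<n. newton_matrix y i l * (w (blk l) * newton_coeff (y (blk l)) s (pos l) j))
      = (\<Sum>l<n. if blk l = blk i \<and> pos l \<le> pos i then ?g (pos l) else 0)"
    by (intro sum.cong) (auto simp: newton_matrix_def)
  also have "\<dots> = (\<Sum>k\<le>pos i. ?g k)"
    using assms blk_less pos_less by (intro sum_index_block) auto
  finally show ?thesis
    using newton_interpolation[of "y (blk i)" "pos i" s j] by (simp add: sum_distrib_left)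
qed

end

section \<open>Determinants of block Vandermonde type\<close>

lemma mat_mult_fun:
  "mat n n (\<lambda>(i, j). f i j) * mat n n (\<lambda>(i, j). g i j) = mat n n (\<lambda>(i, j). \<Sum>l<n. f i l * g l j)"
  for f g :: "nat \<Rightarrow> nat \<Rightarrow> 'a :: comm_ring_1"
  by (intro eq_matI) (auto simp: scalar_prod_def atLeast0LessThan)

lemma det_mult_fun:
  "det (mat n n (\<lambda>(i, j). \<Sum>l<n. f i l * g l j))
     = det (mat n n (\<lambda>(i, j). f i j)) * det (mat n n (\<lambda>(i, j). g i j))"
  for f g :: "nat \<Rightarrow> nat \<Rightarrow> 'a :: comm_ring_1"
  using det_mult[of "mat n n (\<lambda>(i, j). f i j)" n "mat n n (\<lambda>(i, j). g i j)"]
  by (simp add: mat_mult_fun)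

lemma det_transpose_fun:
  "det (mat n n (\<lambda>(i, j). f j i)) = det (mat n n (\<lambda>(i, j). f i j))"
  for f :: "nat \<Rightarrow> nat \<Rightarrow> 'a :: comm_ring_1"
proof -
  have "mat n n (\<lambda>(i, j). f j i) = transpose_mat (mat n n (\<lambda>(i, j). f i j))"
    by (intro eq_matI) auto
  then show ?thesis using det_transpose[OF mat_carrier, of n "\<lambda>(i, j). f i j"] by simp
qed

locale residue_ring_block = residue_ring_at_p A p \<eta> + block_index d n m e
  for A p \<eta> d n m e +
  fixes \<zeta> :: complex
  assumes \<zeta>: "\<zeta> \<in> A" and nonsing: "\<And>S. S \<subseteq> {..<d} \<Longrightarrow> nonsing \<zeta> S"
begin

text \<open>On level \<open>k\<close> the matrix is the Fourier matrix restricted to the set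
  \<open>S k\<close> of blocks with more than \<open>k\<close> members. Gluing the inverses of these
  pieces gives \<open>Y\<close>, and the product of \<open>Y\<close> and \<open>M\<close> is
  diagonal with unit entries.\<close>

lemma res_unit_det_level_blocks:
  "res_unit (det (mat n n (\<lambda>(i, j). if pos i = pos j then \<zeta> ^ (blk i * blk j) else 0)))"
proof -
  define S where "S k = {b. b < d \<and> k < m b}" for k
  define P where "P k X z \<longleftrightarrow> (\<forall>a\<in>S k. \<forall>b\<in>S k. X a b \<in> A) \<and> res_unit z \<and>
     (\<forall>a\<in>S k. \<forall>c\<in>S k. (\<Sum>b\<in>S k. X a b * \<zeta> ^ (b * c)) = (if a = c then z else 0))" for k X z
  have "S k \<subseteq> {..<d}" for k by (auto simp: S_def)
  from nonsing[OF this] have "\<exists>X z. P k X z" for k unfolding nonsing_def P_def .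
  then obtain X z where P: "\<And>k. P k (X k) (z k)" by metis
  have X: "X k a b \<in> A" if "a \<in> S k" "b \<in> S k" for k a b using P[of k] that unfolding P_def by blast
  have z: "res_unit (z k)" for k using P[of k] unfolding P_def by blast
  have eq: "(\<Sum>b\<in>S k. X k a b * \<zeta> ^ (b * c)) = (if a = c then z k else 0)"
    if "a \<in> S k" "c \<in> S k" for k a c using P[of k] that unfolding P_def by blast
  have S: "blk i \<in> S (pos i)" if "i < n" for i using that blk_less pos_less by (simp add: S_def)
  define Y where "Y l i = (if pos l = pos i then X (pos l) (blk l) (blk i) else 0)" for l i
  define M where "M i j = (if pos i = pos j then \<zeta> ^ (blk i * blk j) else 0)" for i j
  have "(\<Sum>i<n. Y l i * M i j) = (if l = j then z (pos l) else 0)" if lj: "l < n" "j < n" for l j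
  proof (cases "pos l = pos j")
    case True
    have "(\<Sum>i<n. Y l i * M i j)
        = (\<Sum>i<n. if pos i = pos l then X (pos l) (blk l) (blk i) * \<zeta> ^ (blk i * blk j) else 0)"
      using True by (intro sum.cong) (auto simp: Y_def M_def)
    also have "\<dots> = (\<Sum>b\<in>S (pos l). X (pos l) (blk l) b * \<zeta> ^ (b * blk j))"
      unfolding S_def by (rule sum_index_level)
    also have "\<dots> = (if blk l = blk j then z (pos l) else 0)"
      using S[OF lj(1)] S[OF lj(2)] True by (intro eq) auto
    finally show ?thesis using True index_eqI lj by auto
  next
    case False
    then have "(\<Sum>i<n. Y l i * M i j) = (\<Sum>i<n. 0)"
      by (intro sum.cong) (auto simp: Y_def M_def)
    then show ?thesis using False by auto
  qed
  then have "mat n n (\<lambda>(l, j). \<Sum>i<n. Y l i * M i j) = mat n n (\<lambda>(l, j). if l = j then z (pos l) else 0)"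
    by (intro eq_matI) auto
  then have "det (mat n n (\<lambda>(i, j). M i j)) * det (mat n n (\<lambda>(i, j). Y i j)) = (\<Prod>l<n. z (pos l))"
    using det_mult_fun[of n Y M] det_diagonal_fun[of n "\<lambda>l. z (pos l)"] by (simp add: mult.commute)
  moreover have "res_unit (\<Prod>l<n. z (pos l))" using z by (rule res_unit_prod)
  moreover have "det (mat n n (\<lambda>(i, j). M i j)) \<in> A"
    by (intro det_mem) (auto simp: M_def intro: mem_intros \<zeta>)
  moreover have "Y i j \<in> A" if "i < n" "j < n" for i j
    using X[of "blk i" "pos i" "blk j"] S that by (auto simp: Y_def intro: zero_mem)
  then have "det (mat n n (\<lambda>(i, j). Y i j)) \<in> A" by (rule det_mem)
  ultimately show ?thesis
    unfolding M_def[symmetric] using res_unit_factor by metis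
qed

text \<open>Multiplying row \<open>i\<close> by \<open>fact (pos i)\<close> turns the binomial
  coefficient into a product of differences, to which Newton interpolation in the columns applies.
  The coefficient matrix \<open>M3\<close> is level triangular with leading coefficients
  \<open>1\<close>. So the determinant times the factorials is a unit, and the determinant divides
  it.\<close>

lemma res_unit_det_binomial:
  fixes c :: "nat \<Rightarrow> nat \<Rightarrow> nat"
  assumes c: "\<And>a k l. a < d \<Longrightarrow> k < m a \<Longrightarrow> l < k \<Longrightarrow> \<not> int p dvd int (c a k) - int (c a l)"
  shows "res_unit (det (mat n n (\<lambda>(i, j). \<zeta> ^ (blk i * blk j) * of_nat (c (blk j) (pos j) choose pos i))))"
proof -
  define y :: "nat \<Rightarrow> nat \<Rightarrow> complex" where "y a k = of_nat (c a k)" for a k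
  define M2 where "M2 i j = \<zeta> ^ (blk i * blk j) * of_nat (c (blk j) (pos j) choose pos i)" for i j
  define M3 where "M3 i l = \<zeta> ^ (blk i * blk l) * newton_coeff (y (blk l)) of_nat (pos l) (pos i)" for i l
  have "(\<Sum>l<n. (if i = l then fact (pos i) else 0) * M2 l j) = (\<Sum>l<n. M3 i l * newton_matrix y j l)"
    if ij: "i < n" "j < n" for i j
  proof -
    have "(\<Sum>l<n. M3 i l * newton_matrix y j l) = (\<Sum>l<n. newton_matrix y j l * (\<zeta> ^ (blk i * blk l) * newton_coeff (y (blk l)) of_nat (pos l) (pos i)))"
      by (simp add: M3_def mult.commute)
    also have "\<dots> = \<zeta> ^ (blk i * blk j) * (\<Prod>t<pos i. y (blk j) (pos j) - of_nat t)"
      using sum_newton_matrix[OF ij(2), of y "\<lambda>b. \<zeta> ^ (blk i * b)" of_nat "pos i"] by simp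
    also have "(\<Prod>t<pos i. y (blk j) (pos j) - of_nat t) = fact (pos i) * of_nat (c (blk j) (pos j) choose pos i)"
      by (simp add: y_def binomial_gbinomial gbinomial_prod_rev atLeast0LessThan)
    finally have "(\<Sum>l<n. M3 i l * newton_matrix y j l) = fact (pos i) * M2 i j"
      by (simp add: M2_def)
    moreover have "(\<Sum>l<n. (if i = l then fact (pos i) else 0) * M2 l j)
        = (\<Sum>l<n. if i = l then fact (pos i) * M2 l j else 0)"
      by (intro sum.cong) auto
    ultimately show ?thesis using ij by simp
  qed
  then have "mat n n (\<lambda>(i, j). \<Sum>l<n. (if i = l then fact (pos i) else 0) * M2 l j)
      = mat n n (\<lambda>(i, j). \<Sum>l<n. M3 i l * newton_matrix y j l)"
    by (intro eq_matI) auto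
  then have "det (mat n n (\<lambda>(i, j). if i = j then fact (pos i) else 0)) * det (mat n n (\<lambda>(i, j). M2 i j))
      = det (mat n n (\<lambda>(i, j). M3 i j)) * det (mat n n (\<lambda>(i, j). newton_matrix y j i))"
    unfolding det_mult_fun[symmetric] by (rule arg_cong)
  then have "(\<Prod>i<n. fact (pos i)) * det (mat n n (\<lambda>(i, j). M2 i j))
      = det (mat n n (\<lambda>(i, j). M3 i j)) * det (mat n n (\<lambda>(i, j). newton_matrix y i j))"
    unfolding det_diagonal_fun det_transpose_fun[of n "newton_matrix y"] .
  moreover have "det (mat n n (\<lambda>(i, j). M3 i j))
      = det (mat n n (\<lambda>(i, j). if pos i = pos j then M3 i j else 0))"
    by (rule det_level_triangular) (auto simp: M3_def newton_coeff_above)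
  moreover have "(\<lambda>(i, j). if pos i = pos j then M3 i j else 0)
      = (\<lambda>(i, j). if pos i = pos j then \<zeta> ^ (blk i * blk j) else 0)"
    by (auto simp: M3_def newton_coeff_diag fun_eq_iff)
  moreover have "res_unit (det (mat n n (\<lambda>(i, j). newton_matrix y i j)))"
    unfolding det_newton_matrix
  proof (intro res_unit_prod)
    fix i t assume "i \<in> {..<n}" "t \<in> {..<pos i}"
    then have "res_unit (of_int (int (c (blk i) (pos i)) - int (c (blk i) t)))"
      using c blk_less pos_less by (intro res_unit_of_int) auto
    then show "res_unit (y (blk i) (pos i) - y (blk i) t)" by (simp add: y_def)
  qed
  ultimately have "res_unit (det (mat n n (\<lambda>(i, j). M2 i j)) * (\<Prod>i<n. fact (pos i)))"
    using res_unit_mult[OF res_unit_det_level_blocks] by (simp only: mult.commute)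
  moreover have "det (mat n n (\<lambda>(i, j). M2 i j)) \<in> A"
    by (intro det_mem) (auto simp: M2_def intro!: mem_intros \<zeta>)
  moreover have "(\<Prod>i<n. fact (pos i)) \<in> A"
    by (intro prod_mem) (metis of_nat_fact of_nat_mem)
  ultimately show ?thesis unfolding M2_def by (rule res_unit_factor)
qed

text \<open>All nodes are congruent to \<open>1\<close>, so the Vandermonde factor may vanish modulo
  \<open>1 - \<eta>\<close>; it is only shown to be nonzero. The other factor \<open>M1\<close> is
  congruent to \<open>M2\<close> and has a unit determinant.\<close>

theorem det_block_vandermonde_nonzero:
  fixes x :: "nat \<Rightarrow> nat \<Rightarrow> complex" and c :: "nat \<Rightarrow> nat \<Rightarrow> nat"
  assumes x: "\<And>a k. a < d \<Longrightarrow> k < m a \<Longrightarrow> x a k \<in> A \<and> x a k \<approx> 1"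
    and x_inj: "\<And>a k l. a < d \<Longrightarrow> k < m a \<Longrightarrow> l < k \<Longrightarrow> x a k \<noteq> x a l"
    and c: "\<And>a k l. a < d \<Longrightarrow> k < m a \<Longrightarrow> l < k \<Longrightarrow> \<not> int p dvd int (c a k) - int (c a l)"
  shows "det (mat n n (\<lambda>(i, j). \<zeta> ^ (blk i * blk j) * x (blk i) (pos i) ^ c (blk j) (pos j))) \<noteq> 0"
proof -
  define M1 where "M1 l j = \<zeta> ^ (blk l * blk j) *
    newton_coeff (x (blk l)) (\<lambda>_. 0) (pos l) (c (blk j) (pos j))" for l j
  define M2 where "M2 i j = \<zeta> ^ (blk i * blk j) * of_nat (c (blk j) (pos j) choose pos i)" for i j
  have "M2 i j \<in> A \<and> M1 i j \<in> A \<and> M2 i j \<approx> M1 i j" if ij: "i < n" "j < n" for i j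
  proof -
    have x': "x (blk i) k \<in> A \<and> x (blk i) k \<approx> 1" if "k \<le> pos i" for k
      using x[of "blk i" k] blk_less[OF ij(1)] pos_less[OF ij(1)] that by simp
    have "newton_coeff (x (blk i)) (\<lambda>_. 0) (pos i) (c (blk j) (pos j)) \<in> A"
      using x' by (intro newton_coeff_mem[of "pos i"]) (auto intro: zero_mem)
    moreover have "newton_coeff (x (blk i)) (\<lambda>_. 0) (pos i) (c (blk j) (pos j))
        \<approx> of_nat (c (blk j) (pos j) choose pos i)"
      using x' by (intro newton_coeff_cong_binomial[of "pos i"]) auto
    ultimately show ?thesis
      unfolding M1_def M2_def
      by (auto intro!: mult_mem power_mem \<zeta> of_nat_mem cong_eta_mult_left intro: cong_eta_sym)
  qed
  then have "det (mat n n (\<lambda>(i, j). M2 i j)) \<approx> det (mat n n (\<lambda>(i, j). M1 i j))"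
    and "det (mat n n (\<lambda>(i, j). M1 i j)) \<in> A"
    by (auto intro!: cong_eta_det det_mem)
  moreover have "res_unit (det (mat n n (\<lambda>(i, j). M2 i j)))"
    unfolding M2_def by (rule res_unit_det_binomial[OF c])
  ultimately have "det (mat n n (\<lambda>(i, j). M1 i j)) \<noteq> 0"
    using res_unit_cong res_unit_nonzero by blast
  moreover have "det (mat n n (\<lambda>(i, j). newton_matrix x i j)) \<noteq> 0"
    unfolding det_newton_matrix using x_inj[OF blk_less pos_less]
    by (auto simp: prod_zero_iff)
  moreover have "mat n n (\<lambda>(i, j). \<zeta> ^ (blk i * blk j) * x (blk i) (pos i) ^ c (blk j) (pos j))
      = mat n n (\<lambda>(i, j). \<Sum>l<n. newton_matrix x i l * M1 l j)"
  proof (intro eq_matI)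
    fix i j assume "i < dim_row (mat n n (\<lambda>(i, j). \<Sum>l<n. newton_matrix x i l * M1 l j))"
      "j < dim_col (mat n n (\<lambda>(i, j). \<Sum>l<n. newton_matrix x i l * M1 l j))"
    then have ij: "i < n" "j < n" by auto
    then show "mat n n (\<lambda>(i, j). \<zeta> ^ (blk i * blk j) * x (blk i) (pos i) ^ c (blk j) (pos j)) $$ (i, j)
      = mat n n (\<lambda>(i, j). \<Sum>l<n. newton_matrix x i l * M1 l j) $$ (i, j)"
      using sum_newton_matrix[OF ij(1), of x "\<lambda>b. \<zeta> ^ (b * blk j)" "\<lambda>_. 0" "c (blk j) (pos j)"]
      by (simp add: M1_def)
  qed auto
  ultimately show ?thesis by (simp add: det_mult_fun)
qed

corollary det_block_fourier_nonzero:
  fixes r c :: "nat \<Rightarrow> nat \<Rightarrow> nat"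
  assumes "\<And>a k l. a < d \<Longrightarrow> k < m a \<Longrightarrow> l < k \<Longrightarrow> \<not> int p dvd int (r a k) - int (r a l)"
    and "\<And>a k l. a < d \<Longrightarrow> k < m a \<Longrightarrow> l < k \<Longrightarrow> \<not> int p dvd int (c a k) - int (c a l)"
  shows "det (mat n n (\<lambda>(i, j). \<zeta> ^ (blk i * blk j) *
    (\<eta> ^ r (blk i) (pos i)) ^ c (blk j) (pos j))) \<noteq> 0"
proof (rule det_block_vandermonde_nonzero[where x = "\<lambda>a k. \<eta> ^ r a k", OF _ _ assms(2)])
  show "\<eta> ^ r a k \<in> A \<and> \<eta> ^ r a k \<approx> 1" for a k
    using power_mem[OF eta_mem] eta_power_cong_1 by blast
  show "\<eta> ^ r a k \<noteq> \<eta> ^ r a l" if "a < d" "k < m a" "l < k" for a k l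
    using eta_power_eqD assms(1)[OF that] by blast
qed

end

section \<open>From Fourier minors to block matrices\<close>

lemma fourier_root_power_eq_1_iff:
  assumes "N > 0" shows "fourier_root N ^ k = 1 \<longleftrightarrow> N dvd k"
proof
  assume "fourier_root N ^ k = 1"
  moreover have "fourier_root N ^ k = exp (of_nat k * (- (2 * complex_of_real pi * \<i>) / of_nat N))"
    unfolding fourier_root_def by (rule exp_of_nat_mult [symmetric])
  moreover have "of_nat k * (- (2 * complex_of_real pi * \<i>) / of_nat N)
      = \<i> * complex_of_real (- (2 * pi * k / N))"
    by simp
  ultimately have "cis (- (2 * pi * k / N)) = 1" by (simp only: cis_conv_exp)
  then have "cos (- (2 * pi * k / N)) = 1" by (simp add: complex_eq_iff)
  then obtain z :: int where "- (2 * pi * k / N) = of_int z * 2 * pi"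
    using cos_one_2pi_int[of "- (2 * pi * k / N)"] by blast
  then have "pi * real k = pi * of_int (- z * int N)" using assms by (simp add: field_simps)
  then have "real k = of_int (- z * int N)" by (metis mult_left_cancel pi_neq_zero)
  then have "int k = - z * int N" by (metis of_int_eq_iff of_int_of_nat_eq)
  then have "int N dvd int k" by simp
  then show "N dvd k" by simp
next
  assume "N dvd k"
  then show "fourier_root N ^ k = 1"
    using fourier_root_power_self[OF assms] by (auto simp: power_mult)
qed

lemma bij_betw_pick:
  assumes "finite S" shows "bij_betw (pick S) {..<card S} S"
proof -
  have "inj_on (pick S) {..<card S}"
    by (rule linorder_inj_onI') (metis lessThan_iff less_irrefl pick_mono_le)
  moreover have "pick S ` {..<card S} \<subseteq> S" using pick_in_set_le by auto
  ultimately show ?thesis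
    using card_subset_eq[OF assms] by (simp add: bij_betw_def card_image)
qed

lemma bij_betw_pick_residues:
  assumes "finite R" "d > 0"
  shows "bij_betw (\<lambda>q. pick {r \<in> R. r mod d = fst q} (snd q))
    (SIGMA a:{..<d}. {..<card {r \<in> R. r mod d = a}}) R"
proof -
  let ?R = "\<lambda>a. {r \<in> R. r mod d = a}"
  have bij: "bij_betw (pick (?R a)) {..<card (?R a)} (?R a)" for a
    using assms by (intro bij_betw_pick) auto
  have mem: "pick (?R a) k \<in> ?R a" if "k < card (?R a)" for a k
    using bij_betwE[OF bij[of a]] that by blast
  show ?thesis
  proof (rule bij_betwI')
    fix q q' assume q: "q \<in> (SIGMA a:{..<d}. {..<card (?R a)})" "q' \<in> (SIGMA a:{..<d}. {..<card (?R a)})"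
    then have k: "snd q < card (?R (fst q))" "snd q' < card (?R (fst q'))" by (auto simp: mem_Sigma_iff)
    show "(pick (?R (fst q)) (snd q) = pick (?R (fst q')) (snd q')) = (q = q')"
    proof
      assume eq: "pick (?R (fst q)) (snd q) = pick (?R (fst q')) (snd q')"
      then have a: "fst q = fst q'" using mem[OF k(1)] mem[OF k(2)] by simp
      then have "snd q = snd q'"
        using eq k inj_onD[OF bij_betw_imp_inj_on[OF bij[of "fst q"]], of "snd q" "snd q'"] by simp
      with a show "q = q'" by (rule prod_eqI)
    qed simp
  next
    fix q assume "q \<in> (SIGMA a:{..<d}. {..<card (?R a)})"
    then show "pick (?R (fst q)) (snd q) \<in> R" using mem[of "snd q" "fst q"] by (auto simp: mem_Sigma_iff)
  next
    fix r assume "r \<in> R"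
    then have "r \<in> pick (?R (r mod d)) ` {..<card (?R (r mod d))}"
      using bij[of "r mod d"] by (simp add: bij_betw_def)
    then obtain k where "k < card (?R (r mod d))" "r = pick (?R (r mod d)) k" by auto
    then show "\<exists>q\<in>(SIGMA a:{..<d}. {..<card (?R a)}). r = pick (?R (fst q)) (snd q)"
      using assms(2) by (intro bexI[of _ "(r mod d, k)"]) auto
  qed
qed

text \<open>The orderings of rows and columns are exchanged one at a time, the columns through the
  transpose.\<close>

lemma fourier_minor_reindex:
  assumes "R \<subseteq> {..<N}" "C \<subseteq> {..<N}" "card R = n" "card C = n"
    and f: "bij_betw f {..<n} R" and g: "bij_betw g {..<n} C"
    and nz: "det (mat n n (\<lambda>(i, j). fourier_root N ^ (f i * g j))) \<noteq> 0"
  shows "fourier_minor N R C \<noteq> 0"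
proof
  let ?w = "fourier_root N"
  assume 0: "fourier_minor N R C = 0"
  have fin: "finite R" "finite C" using assms(1,2) finite_subset by auto
  have R: "{i. i < N \<and> i \<in> R} = R" and C: "{i. i < N \<and> i \<in> C} = C" using assms(1,2) by auto
  have pick: "pick R i < N" "pick C i < N" if "i < n" for i
    using pick_in_set_le[of i R] pick_in_set_le[of i C] that assms by auto
  have "submatrix (fourier_mat N) R C = mat n n (\<lambda>(i, j). ?w ^ (pick R i * pick C j))"
    using pick by (intro eq_matI) (auto simp: submatrix_def fourier_mat_def R C assms(3,4))
  then have "det (mat n n (\<lambda>(i, j). ?w ^ (pick R i * pick C j))) = 0"
    using 0 by (simp add: fourier_minor_def)
  then have "det (mat n n (\<lambda>(i, j). ?w ^ (f i * pick C j))) = 0"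
    using det_reindex_eq_0[of f n R "pick R" "\<lambda>r j. ?w ^ (r * pick C j)"]
      f bij_betw_pick[OF fin(1)] by (simp add: atLeast0LessThan assms(3))
  then have "det (mat n n (\<lambda>(i, j). ?w ^ (f j * pick C i))) = 0"
    using det_transpose_fun[of n "\<lambda>i j. ?w ^ (f i * pick C j)"] by simp
  then have "det (mat n n (\<lambda>(i, j). ?w ^ (f j * g i))) = 0"
    using det_reindex_eq_0[of g n C "pick C" "\<lambda>c j. ?w ^ (f j * c)"]
      g bij_betw_pick[OF fin(2)] by (simp add: atLeast0LessThan assms(4))
  then show False
    using nz det_transpose_fun[of n "\<lambda>i j. ?w ^ (f i * g j)"] by simp
qed

text \<open>The exponents \<open>e1\<close> and \<open>e2\<close> are the idempotents of the Chinese remainder decomposition of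
  \<open>\<int>/dp\<close>.\<close>

theorem fourier_principal_minor_nonzero:
  fixes N d p e1 e2 :: nat
  defines "\<omega> \<equiv> fourier_root N"
  assumes N: "N = d * p" "1 < N" and p: "prime p" "odd p"
    and idem: "p dvd e1" "d dvd e2" "(e1 + e2) mod N = 1"
    and RC: "R \<subseteq> {0..<N}" "C \<subseteq> {0..<N}" and principal: "principal_index_sets d R C"
    and nonsing: "\<And>\<zeta> S. residue_ring_at_p (int_span \<omega>) p (\<omega> ^ e2) \<Longrightarrow> \<zeta> \<in> int_span \<omega> \<Longrightarrow>
      primitive_root d \<zeta> \<Longrightarrow> S \<subseteq> {..<d} \<Longrightarrow> residue_ring_at_p.nonsing (int_span \<omega>) (\<omega> ^ e2) \<zeta> S"
  shows "fourier_minor N R C \<noteq> 0"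
proof -
  have N0: "N > 0" using N(2) by simp
  have \<omega>1: "\<omega> ^ k = 1 \<longleftrightarrow> N dvd k" for k
    unfolding \<omega>_def by (rule fourier_root_power_eq_1_iff[OF N0])
  have d0: "d > 0" "p > 0" using N0 unfolding N(1) nat_0_less_mult_iff by auto
  \<comment> \<open>\<open>e1 + e2\<close> is prime to \<open>N\<close>; since \<open>p\<close>
    divides \<open>e1\<close> and \<open>d\<close> divides \<open>e2\<close>, this separates
    \<open>e2\<close> from \<open>p\<close> and \<open>e1\<close> from \<open>d\<close>.\<close>
  have unit: "g = 1" if g: "g dvd e1 + e2" "g dvd N" for g
  proof -
    have "g dvd (e1 + e2) mod N" using g by (simp add: dvd_mod)
    then show ?thesis using idem(3) by simp
  qed
  have p_e2: "\<not> p dvd e2" using unit[of p] idem(1) N p(1) by (auto simp: dvd_add)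
  have cop: "coprime e1 d"
  proof (rule coprimeI)
    fix g assume "g dvd e1" "g dvd d"
    then have "g dvd e1 + e2" "g dvd N" using idem(2) N(1) by (auto intro: dvd_trans)
    then show "is_unit g" using unit by simp
  qed
  interpret residue_ring_at_p "int_span \<omega>" p "\<omega> ^ e2"
  proof
    show "(\<omega> ^ e2) ^ p = 1" using idem(2) N by (simp add: \<omega>1 mult_dvd_mono flip: power_mult)
    show "\<omega> ^ e2 \<noteq> 1" using p_e2 N by (auto simp: \<omega>1 dest: dvd_mult_right)
    fix x assume "x \<in> int_span \<omega>" "x \<in> \<rat>"
    then show "x \<in> \<int>" using int_span_rat_int[of \<omega> N] \<omega>1[of N] N0 by simp
  qed (use p in \<open>auto intro: int_span_1 int_span_diff int_span_mult int_span_power\<close>)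
  \<comment> \<open>\<open>\<omega>\<close> is the product of \<open>\<zeta>\<close> and
    \<open>\<omega> ^ e2\<close>, because \<open>e1 + e2\<close> is \<open>1\<close> modulo
    \<open>N\<close>.\<close>
  define \<zeta> where "\<zeta> = \<omega> ^ e1"
  have \<zeta>A: "\<zeta> \<in> int_span \<omega>" unfolding \<zeta>_def by (rule int_span_power)
  have \<zeta>d: "\<zeta> ^ d = 1"
    unfolding \<zeta>_def using idem(1) N by (simp add: \<omega>1 mult_dvd_mono mult.commute[of d] flip: power_mult)
  have "\<zeta> ^ k \<noteq> 1" if "0 < k" "k < d" for k
  proof
    assume "\<zeta> ^ k = 1"
    then have "d * p dvd e1 * k" unfolding \<zeta>_def N(1)[symmetric] by (simp add: \<omega>1 flip: power_mult)
    then have "d dvd k" using cop by (metis coprime_commute coprime_dvd_mult_right_iff dvd_mult_left)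
    then show False using that by (auto dest: dvd_imp_le)
  qed
  then have prim: "primitive_root d \<zeta>" using \<zeta>d by (simp add: primitive_root_def)
  let ?R = "\<lambda>a. {r \<in> R. r mod d = a}" and ?C = "\<lambda>a. {c \<in> C. c mod d = a}"
  define m where "m a = card (?R a)" for a
  \<comment> \<open>Principality enters here: one function \<open>m\<close> counts both rows and
    columns, so a single block indexing serves both.\<close>
  have mC: "m a = card (?C a)" if "a < d" for a
    using principal that by (simp add: m_def principal_index_sets_def)
  have fin: "finite R" "finite C" using RC finite_subset by auto
  let ?I = "SIGMA a:{..<d}. {..<m a}"
  define f where "f q = pick (?R (fst q)) (snd q)" for q
  define g where "g q = pick (?C (fst q)) (snd q)" for q
  have f: "bij_betw f ?I R"
    using bij_betw_pick_residues[OF fin(1) d0(1)] unfolding f_def m_def .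
  have "?I = (SIGMA a:{..<d}. {..<card (?C a)})" using mC by auto
  then have g: "bij_betw g ?I C"
    using bij_betw_pick_residues[OF fin(2) d0(1)] unfolding g_def by simp
  define n where "n = card ?I"
  have card: "card R = n" "card C = n"
    using bij_betw_same_card[OF f] bij_betw_same_card[OF g] by (auto simp: n_def)
  obtain h where h: "bij_betw h {..<n} ?I"
    using ex_bij_betw_nat_finite[of ?I] by (auto simp: n_def atLeast0LessThan)
  interpret residue_ring_block "int_span \<omega>" p "\<omega> ^ e2" d n m h \<zeta>
    by unfold_locales (use h \<zeta>A nonsing[OF residue_ring_at_p_axioms \<zeta>A prim] in auto)
  have fm: "f (a, k) \<in> R" "f (a, k) mod d = a" and gm: "g (a, k) \<in> C" "g (a, k) mod d = a"
    if "a < d" "k < m a" for a k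
    using pick_in_set_le[of k "?R a"] pick_in_set_le[of k "?C a"] that mC[of a]
    by (auto simp: f_def g_def m_def)
  have f_ne: "f (a, k) \<noteq> f (a, l)" and g_ne: "g (a, k) \<noteq> g (a, l)"
    if "a < d" "k < m a" "l < k" for a k l
    using that inj_onD[OF bij_betw_imp_inj_on[OF f], of "(a, k)" "(a, l)"]
      inj_onD[OF bij_betw_imp_inj_on[OF g], of "(a, k)" "(a, l)"] by auto
  \<comment> \<open>Chinese remainder theorem: distinct indices in one class modulo \<open>d\<close>
    stay distinct modulo \<open>p\<close>.\<close>
  have p_diff: "x = y" if "x < N" "y < N" "x mod d = y mod d" "int p dvd int x - int y" for x y
  proof -
    have "int d dvd int x - int y"
      using that(3) by (simp add: mod_eq_dvd_iff[symmetric] flip: of_nat_mod)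
    moreover have "coprime (int d) (int p)"
    proof -
      have "coprime p d" by (rule coprime_divisors[OF idem(1) dvd_refl cop])
      then show ?thesis by (simp add: coprime_commute)
    qed
    ultimately have "int N dvd int x - int y"
      using that(4) N(1) by (simp add: divides_mult)
    then show ?thesis using that(1,2) zdvd_imp_le[of "int N" "\<bar>int x - int y\<bar>"] by force
  qed
  have "det (mat n n (\<lambda>(i, j). \<zeta> ^ (blk i * blk j) *
      ((\<omega> ^ e2) ^ f (blk i, pos i)) ^ g (blk j, pos j))) \<noteq> 0"
  proof (rule det_block_fourier_nonzero[of "\<lambda>a k. f (a, k)" "\<lambda>a k. g (a, k)"])
    fix a k l assume akl: "a < d" "k < m a" "l < k"
    then have l: "l < m a" by simp
    have "f (a, k) < N" "f (a, l) < N" "g (a, k) < N" "g (a, l) < N"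
      using fm(1)[OF akl(1,2)] fm(1)[OF akl(1) l] gm(1)[OF akl(1,2)] gm(1)[OF akl(1) l] RC
      by (meson atLeastLessThan_iff subsetD)+
    moreover have "f (a, k) mod d = f (a, l) mod d" "g (a, k) mod d = g (a, l) mod d"
      using fm(2)[OF akl(1,2)] fm(2)[OF akl(1) l] gm(2)[OF akl(1,2)] gm(2)[OF akl(1) l] by simp_all
    ultimately show "\<not> int p dvd int (f (a, k)) - int (f (a, l))"
      "\<not> int p dvd int (g (a, k)) - int (g (a, l))"
      using p_diff f_ne[OF akl] g_ne[OF akl] by blast+
  qed
  moreover have "\<zeta> ^ (blk i * blk j) * ((\<omega> ^ e2) ^ f (blk i, pos i)) ^ g (blk j, pos j)
      = \<omega> ^ (f (h i) * g (h j))" if ij: "i < n" "j < n" for i j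
  proof -
    let ?r = "f (h i)" and ?c = "g (h j)"
    have "?r mod d = blk i" "?c mod d = blk j"
      using fm(2)[of "blk i" "pos i"] gm(2)[of "blk j" "pos j"] blk_less pos_less ij by auto
    \<comment> \<open>Exponents of \<open>\<zeta>\<close> count only modulo \<open>d\<close>, so
      classes may be replaced by the indices themselves.\<close>
    then have "\<zeta> ^ (blk i * blk j) = \<zeta> ^ (?r * ?c)"
      using power_mod_order[OF \<zeta>d] by (metis mod_mult_eq)
    moreover have "((\<omega> ^ e2) ^ ?r) ^ ?c = (\<omega> ^ e2) ^ (?r * ?c)" by (simp add: power_mult)
    moreover have "\<zeta> ^ (?r * ?c) * (\<omega> ^ e2) ^ (?r * ?c) = (\<omega> ^ (e1 + e2)) ^ (?r * ?c)"
      by (simp add: \<zeta>_def power_add power_mult_distrib)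
    moreover have "\<omega> ^ (e1 + e2) = \<omega>"
      using power_mod_order[of \<omega> N "e1 + e2"] \<omega>1[of N] idem(3) by simp
    ultimately show ?thesis by simp
  qed
  then have "mat n n (\<lambda>(i, j). \<zeta> ^ (blk i * blk j) * ((\<omega> ^ e2) ^ f (blk i, pos i)) ^ g (blk j, pos j))
      = mat n n (\<lambda>(i, j). \<omega> ^ ((f \<circ> h) i * (g \<circ> h) j))"
    by (intro eq_matI) auto
  ultimately have "det (mat n n (\<lambda>(i, j). \<omega> ^ ((f \<circ> h) i * (g \<circ> h) j))) \<noteq> 0" by simp
  then show ?thesis
    using RC card bij_betw_trans[OF h f] bij_betw_trans[OF h g] unfolding \<omega>_def
    by (intro fourier_minor_reindex[of R N C n "f \<circ> h" "g \<circ> h"]) auto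
qed

theorem mainTheorem2:
  fixes N d :: nat and R C :: "nat set"
  assumes "(N, d) \<in> {(70, 10), (143, 11)}"
    and "R \<subseteq> {0..<N}" and "C \<subseteq> {0..<N}"
    and "card R = card C"
    and "principal_index_sets d R C"
  shows "fourier_minor N R C \<noteq> 0"
proof -
  have "prime (7 :: nat)" "prime (13 :: nat)" by simp_all
  consider "N = 70" "d = 10" | "N = 143" "d = 11" using assms(1) by auto
  then show ?thesis
  proof cases
    case 1
    show ?thesis
    \<comment> \<open>\<open>21\<close> is \<open>0\<close> modulo \<open>7\<close> and
      \<open>1\<close> modulo \<open>10\<close>; \<open>50\<close> is \<open>1\<close> modulo
      \<open>7\<close> and \<open>0\<close> modulo \<open>10\<close>.\<close>
    proof (rule fourier_principal_minor_nonzero[of N d 7 21 50])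
      fix \<zeta> S assume "residue_ring_at_p (int_span (fourier_root N)) 7 (fourier_root N ^ 50)"
        "\<zeta> \<in> int_span (fourier_root N)" "primitive_root d \<zeta>" "S \<subseteq> {..<d}"
      then show "residue_ring_at_p.nonsing (int_span (fourier_root N)) (fourier_root N ^ 50) \<zeta> S"
        unfolding 1 by (intro residue_ring_at_p.nonsing_7) auto
    qed (use assms 1 \<open>prime 7\<close> in auto)
  next
    case 2
    show ?thesis
    \<comment> \<open>\<open>78\<close> is \<open>0\<close> modulo \<open>13\<close> and
      \<open>1\<close> modulo \<open>11\<close>; \<open>66\<close> is \<open>1\<close> modulo
      \<open>13\<close> and \<open>0\<close> modulo \<open>11\<close>.\<close>
    proof (rule fourier_principal_minor_nonzero[of N d 13 78 66])
      fix \<zeta> S assume "residue_ring_at_p (int_span (fourier_root N)) 13 (fourier_root N ^ 66)"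
        "\<zeta> \<in> int_span (fourier_root N)" "primitive_root d \<zeta>" "S \<subseteq> {..<d}"
      then show "residue_ring_at_p.nonsing (int_span (fourier_root N)) (fourier_root N ^ 66) \<zeta> S"
        unfolding 2 by (intro residue_ring_at_p.nonsing_13) auto
    qed (use assms 2 \<open>prime 13\<close> in auto)
  qed
qed

end
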